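(* Let $\mathsf A,\mathsf B$ be finite-dimensional complex Hilbert spaces. For $\rho\in \mathrm D(\mathsf A\otimes\mathsf B)$ with $\rho_{\mathsf A}>0$ define $$\mathrm N_{\mathsf A}(\rho):=\frac1{d_{\mathsf A}}\left(\rho_{\mathsf A}^{-1/2}\otimes I_{\mathsf B}\right)\rho\left(\rho_{\mathsf A}^{-1/2}\otimes I_{\mathsf B}\right).$$ Then the following hold. (1) (Projection.) For every $\rho\in \mathrm D(\mathsf A\otimes\mathsf B)$ with $\rho_{\mathsf A}>0$, $\mathrm N_{\mathsf A}(\rho)$ is the unique maximizer of $\mathrm F(\rho,\sigma)$ over $\sigma\in\mathcal C_{\mathsf A,\mathsf B}$, and equivalently the unique minimizer over $\sigma\in\mathcal C_{\mathsf A,\mathsf B}$ of $\mathrm d_{\mathrm B}(\rho,\sigma)$ and of $\mathrm d_{\mathrm p}(\rho,\sigma)$. Write $\Pi_{\mathcal C}(\rho):=\mathrm N_{\mathsf A}(\rho)$. (2) (Stability.) Let $\rho\in\mathcal C_{\mathsf A,\mathsf B}$ and let $\hat\rho\in \mathrm D(\mathsf A\otimes\mathsf B)$ with $\hat\rho_{\mathsf A}>0$. Then $$\mathrm d_{\mathrm B}(\rho,\Pi_{\mathcal C}(\hat\rho))\le 2\,\mathrm d_{\mathrm B}(\rho,\hat\rho)\quad\text{and}\quad 1-\mathrm F(\rho,\Pi_{\mathcal C}(\hat\rho))\le 4\left(1-\mathrm F(\rho,\hat\rho)\right).$$ (3) (Lifting.) Let $\varepsilon,\delta\in(0,1)$,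 and let $\mathcal A_{\mathrm{QST}}$ be a quantum state tomography algorithm that, for each accuracy $\varepsilon'\in(0,1)$, given $N(\varepsilon')$ copies of an unknown state, returns an estimate having fidelity at least $1-\varepsilon'$ with that state, with probability at least $1-\delta$. Let $\Phi$ be an unknown quantum channel from $\mathsf A$ to $\mathsf B$, and let $\hat\rho\in\mathrm D(\mathsf A\otimes\mathsf B)$ be the (random) output of $\mathcal A_{\mathrm{QST}}$ run at accuracy $\varepsilon/4$ on $N(\varepsilon/4)$ copies of its Choi state $\mathfrak C(\Phi)$; assume $\hat\rho_{\mathsf A}>0$. Then, with probability at least $1-\delta$, the channel $\hat\Phi$ with Choi state $\mathfrak C(\hat\Phi):=\Pi_{\mathcal C}(\hat\rho)$ satisfies $\mathrm F(\mathfrak C(\Phi),\mathfrak C(\hat\Phi))\ge 1-\varepsilon$. That is, $\Pi_{\mathcal C}\circ\mathcal A_{\mathrm{QST}}$ is a quantum process tomography algorithm of accuracy $\varepsilon$ and confidence $1-\delta$ that uses $N(\varepsilon/4)$ copies of the Choi state.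
   Context: $d_{\mathsf A}=\dim\mathsf A$, $d_{\mathsf B}=\dim\mathsf B$. $\mathrm D(\mathsf X)$ is the set of density matrices (positive semidefinite, trace one) on $\mathsf X$. For an operator $P$ on $\mathsf A\otimes\mathsf B$, $P_{\mathsf A}:=\mathrm{Tr}_{\mathsf B}[P]$. The (root) fidelity is $\mathrm F(\rho,\sigma):=\|\rho^{1/2}\sigma^{1/2}\|_1$ (trace norm). For states, the Bures distance is $\mathrm d_{\mathrm B}(\rho,\sigma):=\sqrt{2-2\mathrm F(\rho,\sigma)}$ and the purified distance is $\mathrm d_{\mathrm p}(\rho,\sigma):=\sqrt{1-\mathrm F(\rho,\sigma)^2}$. A quantum channel from $\mathsf A$ to $\mathsf B$ is a completely positive trace-preserving linear map from operators on $\mathsf A$ to operators on $\mathsf B$. The normalized Choi state of a completely positive map $\Theta$ is $\mathfrak C(\Theta):=(\mathrm{Id}_{\mathsf A}\otimes\Theta)(|\omega\rangle\langle\omega|)$ with $|\omega\rangle=d_{\mathsf A}^{-1/2}\sum_i|i,i\rangle$. The set of Choi states of channels is $\mathcal C_{\mathsf A,\mathsf B}:=\{\rho\in\mathrm D(\mathsf A\otimes\mathsf B):\mathrm{Tr}_{\mathsf B}[\rho]=I_{\mathsf A}/d_{\mathsf A}\}$; $\mathfrak C$ is a bijection from channels onto $\mathcal C_{\mathsf A,\mathsf B}$. A state tomography algorithm may be treated as a procedure whose output is a random density matrix with distribution depending on the unknown state. *)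

theory Defs
  imports "HOL-Probability.Probability"
begin

text \<open>
  A finite-dimensional Hilbert space is \<open>\<complex>\<close> to the power of a finite index type; operators on
  \<open>A \<otimes> B\<close> are matrices indexed by the product type \<open>'a \<times> 'b\<close>.
\<close>

type_synonym 'n operator = "complex ^ 'n ^ 'n"

subsection \<open>Operators\<close>

definition cinner :: "complex ^ 'n::finite \<Rightarrow> complex ^ 'n \<Rightarrow> complex" where
  "cinner x y = (\<Sum>i\<in>UNIV. cnj (x $ i) * y $ i)"

definition adjoint_op :: "'n::finite operator \<Rightarrow> 'n operator" where
  "adjoint_op X = map_matrix cnj (transpose X)"

text \<open>Over \<open>\<complex>\<close>, a real nonnegative quadratic form makes the operator Hermitian.\<close>

definition psd :: "'n::finite operator \<Rightarrow> bool" where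
  "psd X \<longleftrightarrow> (\<forall>x. cinner x (X *v x) \<in> \<real>\<^sub>\<ge>\<^sub>0)"

definition pos_def :: "'n::finite operator \<Rightarrow> bool" where
  "pos_def X \<longleftrightarrow> psd X \<and> (\<forall>x. x \<noteq> 0 \<longrightarrow> cinner x (X *v x) \<noteq> 0)"

text \<open>Meaningful for positive semidefinite arguments only.\<close>

definition op_sqrt :: "'n::finite operator \<Rightarrow> 'n operator" where
  "op_sqrt X = (THE Y. psd Y \<and> Y ** Y = X)"

definition trace_norm :: "'n::finite operator \<Rightarrow> real" where
  "trace_norm X = Re (trace (op_sqrt (adjoint_op X ** X)))"

definition density_ops :: "'n::finite operator set" where
  "density_ops = {\<rho>. psd \<rho> \<and> trace \<rho> = 1}"

definition tensor_op :: "'a::finite operator \<Rightarrow> 'b::finite operator \<Rightarrow> ('a \<times> 'b) operator" where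
  "tensor_op X Y = (\<chi> i j. X $ fst i $ fst j * Y $ snd i $ snd j)"

text \<open>The partial trace over the second factor.\<close>

definition reduce_A :: "('a::finite \<times> 'b::finite) operator \<Rightarrow> 'a operator" where
  "reduce_A P = (\<chi> i j. \<Sum>b\<in>UNIV. P $ (i, b) $ (j, b))"

definition fidelity :: "'n::finite operator \<Rightarrow> 'n operator \<Rightarrow> real" where
  "fidelity \<rho> \<sigma> = trace_norm (op_sqrt \<rho> ** op_sqrt \<sigma>)"

definition bures_dist :: "'n::finite operator \<Rightarrow> 'n operator \<Rightarrow> real" where
  "bures_dist \<rho> \<sigma> = sqrt (2 - 2 * fidelity \<rho> \<sigma>)"

definition purified_dist :: "'n::finite operator \<Rightarrow> 'n operator \<Rightarrow> real" where
  "purified_dist \<rho> \<sigma> = sqrt (1 - (fidelity \<rho> \<sigma>)\<^sup>2)"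

subsection \<open>Channels and Choi states\<close>

definition complex_linear_map :: "('a::finite operator \<Rightarrow> 'b::finite operator) \<Rightarrow> bool" where
  "complex_linear_map \<Phi> \<longleftrightarrow>
     (\<forall>X Y. \<Phi> (X + Y) = \<Phi> X + \<Phi> Y) \<and>
     (\<forall>c X. \<Phi> (map_matrix ((*) c) X) = map_matrix ((*) c) (\<Phi> X))"

text \<open>
  The dimension \<open>n\<close> of the reference system ranges over all naturals, so operators on
  \<open>\<complex>\<^sup>n \<otimes> A\<close> are given by their \<open>n \<times> n\<close> blocks, on which \<open>Id \<otimes> \<Phi>\<close> acts entrywise.
\<close>

definition block_psd :: "nat \<Rightarrow> (nat \<Rightarrow> nat \<Rightarrow> 'a::finite operator) \<Rightarrow> bool" where
  "block_psd n X \<longleftrightarrow> (\<forall>v. (\<Sum>i<n. \<Sum>j<n. cinner (v i) (X i j *v v j)) \<in> \<real>\<^sub>\<ge>\<^sub>0)"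

definition completely_positive :: "('a::finite operator \<Rightarrow> 'b::finite operator) \<Rightarrow> bool" where
  "completely_positive \<Phi> \<longleftrightarrow>
     (\<forall>n X. block_psd n X \<longrightarrow> block_psd n (\<lambda>i j. \<Phi> (X i j)))"

definition quantum_channel :: "('a::finite operator \<Rightarrow> 'b::finite operator) \<Rightarrow> bool" where
  "quantum_channel \<Phi> \<longleftrightarrow>
     complex_linear_map \<Phi> \<and> completely_positive \<Phi> \<and> (\<forall>X. trace (\<Phi> X) = trace X)"

text \<open>The map \<open>Id \<otimes> \<Phi>\<close>, applied to the blocks of \<open>P\<close> with respect to the first factor.\<close>

definition id_tensor ::
  "('a::finite operator \<Rightarrow> 'b::finite operator) \<Rightarrow> ('r::finite \<times> 'a) operator \<Rightarrow> ('r \<times> 'b) operator" where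
  "id_tensor \<Phi> P =
     (\<chi> i j. \<Phi> (\<chi> k l. P $ (fst i, k) $ (fst j, l)) $ snd i $ snd j)"

definition ketbra :: "complex ^ 'n::finite \<Rightarrow> 'n operator" where
  "ketbra v = (\<chi> i j. v $ i * cnj (v $ j))"

definition max_entangled :: "complex ^ ('a::finite \<times> 'a)" where
  "max_entangled = (\<chi> i. if fst i = snd i then of_real (1 / sqrt (real CARD('a))) else 0)"

definition choi :: "('a::finite operator \<Rightarrow> 'b::finite operator) \<Rightarrow> ('a \<times> 'b) operator" where
  "choi \<Phi> = id_tensor \<Phi> (ketbra max_entangled)"

definition choi_states :: "('a::finite \<times> 'b::finite) operator set" where
  "choi_states = {\<rho> \<in> density_ops. reduce_A \<rho> = (1 / real CARD('a)) *\<^sub>R mat 1}"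

definition normalize_A :: "('a::finite \<times> 'b::finite) operator \<Rightarrow> ('a \<times> 'b) operator" where
  "normalize_A \<rho> =
     (let K = tensor_op (matrix_inv (op_sqrt (reduce_A \<rho>))) (mat 1)
      in (1 / real CARD('a)) *\<^sub>R (K ** \<rho> ** K))"

definition proj_choi :: "('a::finite \<times> 'b::finite) operator \<Rightarrow> ('a \<times> 'b) operator" where
  "proj_choi \<rho> = normalize_A \<rho>"

subsection \<open>Tomography\<close>

text \<open>
  Since \<open>n\<close> varies, the \<open>n\<close>-fold tensor power is indexed by words of length \<open>n\<close>.
\<close>

type_synonym 'n multi_operator = "'n list \<Rightarrow> 'n list \<Rightarrow> complex"

definition copies :: "nat \<Rightarrow> 'n::finite operator \<Rightarrow> 'n multi_operator" where
  "copies n \<rho> = (\<lambda>xs ys. if length xs = n \<and> length ys = n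
                          then \<Prod>i<n. \<rho> $ (xs ! i) $ (ys ! i) else 0)"

text \<open>
  A tomography procedure maps the available copies to the distribution of its random output.
  A random channel is represented by its Choi state.
\<close>

definition state_tomography ::
  "(real \<Rightarrow> 'n::finite multi_operator \<Rightarrow> 'n operator measure) \<Rightarrow> (real \<Rightarrow> nat) \<Rightarrow> real \<Rightarrow> bool" where
  "state_tomography alg N \<delta> \<longleftrightarrow>
     (\<forall>\<epsilon>\<in>{0<..<1}. \<forall>\<rho>\<in>density_ops.
        let M = alg \<epsilon> (copies (N \<epsilon>) \<rho>) in
          prob_space M \<and> sets M = sets borel \<and> (AE \<sigma> in M. \<sigma> \<in> density_ops) \<and>
          measure M {\<sigma> \<in> density_ops. fidelity \<rho> \<sigma> \<ge> 1 - \<epsilon>} \<ge> 1 - \<delta>)"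

definition process_tomography ::
  "(('a::finite \<times> 'b::finite) multi_operator \<Rightarrow> ('a \<times> 'b) operator measure)
     \<Rightarrow> nat \<Rightarrow> real \<Rightarrow> real \<Rightarrow> bool" where
  "process_tomography alg n \<epsilon> \<delta> \<longleftrightarrow>
     (\<forall>\<Phi> :: 'a operator \<Rightarrow> 'b operator. quantum_channel \<Phi> \<longrightarrow>
        (let M = alg (copies n (choi \<Phi>)) in
          prob_space M \<and> sets M = sets borel \<and>
          (AE \<sigma> in M. \<exists>\<Psi>. quantum_channel \<Psi> \<and> choi \<Psi> = \<sigma>) \<and>
          measure M {choi \<Psi> |\<Psi>. quantum_channel \<Psi> \<and> fidelity (choi \<Phi>) (choi \<Psi>) \<ge> 1 - \<epsilon>}
            \<ge> 1 - \<delta>))"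

end

theory Submission imports Defs begin

text \<open>
  By polar decomposition, \<open>fidelity \<rho> \<sigma>\<close> is the maximum of \<open>Re (trace (\<rho>\<^sup>1\<^sup>/\<^sup>2 B))\<close> over all \<open>B\<close> with
  \<open>B B\<^sup>* = \<sigma>\<close>, so the Bures distance is a minimum of Frobenius distances over unitarily related
  square roots and satisfies the triangle inequality. Let \<open>L\<close> be the square root of \<open>\<rho>\<^sub>A\<close> tensored with
  the identity, \<open>c = 1 / sqrt d\<^sub>A\<close> and \<open>D = B - c L\<^sup>-\<^sup>1 \<rho>\<^sup>1\<^sup>/\<^sup>2\<close>. If \<open>B B\<^sup>*\<close> is a Choi state,
  expanding \<open>trace (D\<^sup>* L D) \<ge> 0\<close> bounds the overlap of \<open>\<rho>\<^sup>1\<^sup>/\<^sup>2\<close> with \<open>B\<close> by the value attained at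
  \<open>normalize_A \<rho>\<close>, and equality forces \<open>D = 0\<close>. Stability is then the triangle inequality through
  \<open>\<rho>'\<close>. Lifting to tomography needs Choi's theorem and the Borel measurability of \<open>proj_choi\<close>.
\<close>

subsection \<open>Adjoints and positive semidefinite operators\<close>

text \<open>The weight \<open>L\<close> is what makes the square
  \<open>trace (adjoint_op D ** L ** D)\<close> useful. It cancels the inverse root in
  \<open>D\<close>, so the cross term is exactly the overlap to be bounded. It acts on the first
  factor only, so the term quadratic in \<open>B\<close> sees nothing of the competitor but its
  marginal, which all Choi states share; the bound is thus the same number for every competitor. The
  constant \<open>c\<close> makes the two squared terms equal. Only the marginal of
  \<open>\<rho>\<close> is invertible while \<open>\<rho>\<close> may be singular, so uniqueness has
  to come from cancelling \<open>L\<close>, not the root of \<open>\<rho>\<close>. The factor 2 in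
  stability arises because the true Choi state is itself a competitor in the projection of the
  estimate, so both legs of the triangle are bounded by the same distance. The squared Bures
  distance is twice the infidelity, whence the 4 and the accuracy \<open>\<epsilon> / 4\<close>. In
  the lifting, probabilities are meaningful only for Borel events, so \<open>proj_choi\<close> has
  to be controlled on all operators, including those where the inverse root is a default
  value.\<close>

lemma adjoint_op_nth [simp]: "adjoint_op X $ i $ j = cnj (X $ j $ i)"
  by (simp add: adjoint_op_def map_matrix_def transpose_def)

lemma adjoint_op_adjoint_op [simp]: "adjoint_op (adjoint_op X) = X"
  by (simp add: vec_eq_iff)

lemma adjoint_op_mult: "adjoint_op (X ** Y) = adjoint_op Y ** adjoint_op X"
  by (simp add: vec_eq_iff matrix_matrix_mult_def mult.commute)

lemma adjoint_op_add: "adjoint_op (X + Y) = adjoint_op X + adjoint_op Y"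
  by (simp add: vec_eq_iff)

lemma adjoint_op_diff: "adjoint_op (X - Y) = adjoint_op X - adjoint_op Y"
  by (simp add: vec_eq_iff)

lemma adjoint_op_scaleR: "adjoint_op (c *\<^sub>R X) = c *\<^sub>R adjoint_op X"
  by (simp add: vec_eq_iff)

lemma adjoint_op_mat_1 [simp]: "adjoint_op (mat 1) = mat 1"
  by (auto simp: vec_eq_iff mat_def)

lemma trace_adjoint_op: "trace (adjoint_op X) = cnj (trace X)"
  by (simp add: trace_def)

lemma trace_scaleR: "trace (c *\<^sub>R (X :: 'n::finite operator)) = c *\<^sub>R trace X"
  by (simp add: trace_def scaleR_sum_right)

lemma inner_operator: "X \<bullet> Y = Re (trace (adjoint_op X ** Y))"
proof -
  have "X \<bullet> Y = (\<Sum>i\<in>UNIV. \<Sum>j\<in>UNIV. Re (cnj (X $ i $ j) * Y $ i $ j))"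
    by (simp add: inner_vec_def inner_complex_def)
  also have "\<dots> = (\<Sum>j\<in>UNIV. \<Sum>i\<in>UNIV. Re (cnj (X $ i $ j) * Y $ i $ j))"
    by (rule sum.swap)
  finally show ?thesis
    by (simp add: trace_def matrix_matrix_mult_def)
qed

lemma norm_operator_squared: "(norm X)\<^sup>2 = Re (trace (adjoint_op X ** X))"
  by (simp add: power2_norm_eq_inner inner_operator)

section \<open>The complex inner product and linearity of the matrix operations\<close>

lemma cinner_add_left: "cinner (x + y) z = cinner x z + cinner y z"
  by (simp add: cinner_def sum.distrib algebra_simps)

lemma cinner_add_right: "cinner x (y + z) = cinner x y + cinner x z"
  by (simp add: cinner_def sum.distrib algebra_simps)

lemma cinner_diff_right: "cinner x (y - z) = cinner x y - cinner x z"
  by (simp add: cinner_def sum_subtractf algebra_simps)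

lemma cinner_scale_left: "cinner (c *s x) y = cnj c * cinner x y"
  by (simp add: cinner_def sum_distrib_left mult.assoc)

lemma cinner_scale_right: "cinner x (c *s y) = c * cinner x y"
  by (simp add: cinner_def sum_distrib_left mult.left_commute)

lemma cinner_scaleR_right: "cinner x (c *\<^sub>R y) = c *\<^sub>R cinner x y"
  by (simp add: cinner_def scaleR_sum_right)

lemma cinner_zero [simp]: "cinner 0 x = 0" "cinner x 0 = 0"
  by (simp_all add: cinner_def)

lemma cinner_commute: "cinner y x = cnj (cinner x y)"
  by (simp add: cinner_def mult.commute)

lemma cinner_self: "cinner x x = of_real ((norm x)\<^sup>2)"
proof -
  have "(norm x)\<^sup>2 = (\<Sum>i\<in>UNIV. (norm (x $ i))\<^sup>2)"
    by (simp add: norm_vec_def L2_set_def sum_nonneg)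
  then show ?thesis
    by (simp only: cinner_def of_real_sum complex_norm_square mult.commute)
qed

lemma cinner_adjoint: "cinner x (X *v y) = cinner (adjoint_op X *v x) y"
proof -
  have "cinner x (X *v y) = (\<Sum>i\<in>UNIV. \<Sum>j\<in>UNIV. cnj (x $ i) * X $ i $ j * y $ j)"
    by (simp add: cinner_def matrix_vector_mult_def sum_distrib_left mult.assoc)
  also have "\<dots> = (\<Sum>j\<in>UNIV. \<Sum>i\<in>UNIV. cnj (x $ i) * X $ i $ j * y $ j)"
    by (rule sum.swap)
  also have "\<dots> = cinner (adjoint_op X *v x) y"
    by (simp add: cinner_def matrix_vector_mult_def sum_distrib_left sum_distrib_right mult.commute mult.left_commute)
  finally show ?thesis .
qed

lemma matrix_vector_scale: "(X :: 'n::finite operator) *v (c *s x) = c *s (X *v x)"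
  by (simp add: vec_eq_iff matrix_vector_mult_def sum_distrib_left mult.left_commute)

lemma matrix_vector_scaleR: "(X :: 'n::finite operator) *v (c *\<^sub>R x) = c *\<^sub>R (X *v x)"
  by (simp add: vec_eq_iff matrix_vector_mult_def scaleR_sum_right)

lemma matrix_mult_0_right: "(X :: 'n::finite operator) ** 0 = 0"
  by (simp add: vec_eq_iff matrix_matrix_mult_def)

lemma scaleR_matrix_vector: "(c *\<^sub>R (X :: 'n::finite operator)) *v x = c *\<^sub>R (X *v x)"
  by (simp add: vec_eq_iff matrix_vector_mult_def scaleR_sum_right)

lemma scaleR_matrix_mult: "(c *\<^sub>R (X :: 'n::finite operator)) ** Y = c *\<^sub>R (X ** Y)"
  by (simp add: vec_eq_iff matrix_matrix_mult_def scaleR_sum_right)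

lemma matrix_mult_scaleR: "(X :: 'n::finite operator) ** (c *\<^sub>R Y) = c *\<^sub>R (X ** Y)"
  by (simp add: vec_eq_iff matrix_matrix_mult_def scaleR_sum_right)

lemma matrix_mult_add_left: "((X :: 'n::finite operator) + Y) ** Z = X ** Z + Y ** Z"
  by (simp add: vec_eq_iff matrix_matrix_mult_def sum.distrib algebra_simps)

lemma matrix_mult_add_right: "(X :: 'n::finite operator) ** (Y + Z) = X ** Y + X ** Z"
  by (simp add: vec_eq_iff matrix_matrix_mult_def sum.distrib algebra_simps)

lemma matrix_mult_diff_left: "((X :: 'n::finite operator) - Y) ** Z = X ** Z - Y ** Z"
  by (simp add: vec_eq_iff matrix_matrix_mult_def sum_subtractf algebra_simps)

lemma matrix_mult_diff_right: "(X :: 'n::finite operator) ** (Y - Z) = X ** Y - X ** Z"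
  by (simp add: vec_eq_iff matrix_matrix_mult_def sum_subtractf algebra_simps)

text \<open>Complex polarization: expanding the form at \<open>M *v y + c *s y\<close> leaves only
  cross terms, and \<open>c = 1\<close> together with \<open>c = \<i>\<close> separates them, so
  \<open>cinner (M *v y) (M *v y)\<close> vanishes. Over the reals a rotation by a right angle is a
  counterexample.\<close>

lemma quadratic_form_zero:
  assumes "\<And>x. cinner x (M *v x) = 0"
  shows "M = 0"
proof -
  have "M *v y = 0" for y
  proof -
    let ?x = "M *v y"
    have eq: "c * cinner ?x (M *v y) + cnj c * cinner y (M *v ?x) = 0" for c
      using assms[of "?x + c *s y"] assms[of ?x] assms[of y]
      by (simp add: matrix_vector_right_distrib matrix_vector_scale cinner_add_left cinner_add_right
          cinner_scale_left cinner_scale_right add.commute)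
    from eq[of 1] eq[of \<i>] have "cinner ?x ?x = 0"
      by (auto simp: complex_eq_iff)
    then show ?thesis by (simp add: cinner_self)
  qed
  then show ?thesis by (simp add: matrix_eq)
qed

text \<open>The form of \<open>X - adjoint_op X\<close> is \<open>2 * \<i>\<close> times an
  imaginary part that \<open>psd\<close> forces to be 0, so polarization applies.\<close>

lemma psd_hermitian:
  assumes "psd X"
  shows "adjoint_op X = X"
proof -
  have "cinner x ((X - adjoint_op X) *v x) = 0" for x
  proof -
    have "Im (cinner x (X *v x)) = 0"
      using assms unfolding psd_def complex_nonneg_Reals_iff by blast
    moreover have "cinner x (adjoint_op X *v x) = cnj (cinner x (X *v x))"
      by (metis adjoint_op_adjoint_op cinner_adjoint cinner_commute)
    ultimately show ?thesis
      by (simp add: matrix_vector_mult_diff_rdistrib cinner_diff_right complex_eq_iff)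
  qed
  then have "X - adjoint_op X = 0" by (rule quadratic_form_zero)
  then show ?thesis by simp
qed

lemma psdI_hermitian:
  assumes "adjoint_op X = X" "\<And>x. Re (cinner x (X *v x)) \<ge> 0"
  shows "psd X"
  unfolding psd_def complex_nonneg_Reals_iff
proof (intro allI conjI)
  fix x
  have "cinner x (X *v x) = cnj (cinner x (X *v x))"
    by (metis assms(1) cinner_adjoint cinner_commute)
  then show "Im (cinner x (X *v x)) = 0" by (simp add: complex_eq_iff)
qed (rule assms)

lemma psd_quadratic_form_nonneg: "psd X \<Longrightarrow> Re (cinner x (X *v x)) \<ge> 0"
  by (simp add: psd_def complex_nonneg_Reals_iff)

lemma psd_0 [simp]: "psd 0"
  by (simp add: psd_def)

lemma psd_mat_1 [simp]: "psd (mat 1)"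
  by (rule psdI_hermitian) (simp_all add: cinner_self)

lemma psd_add: "psd X \<Longrightarrow> psd Y \<Longrightarrow> psd (X + Y)"
  by (simp add: psd_def matrix_vector_mult_add_rdistrib cinner_add_right)

lemma psd_scaleR: "psd X \<Longrightarrow> 0 \<le> c \<Longrightarrow> psd (c *\<^sub>R X)"
  by (simp add: psd_def scaleR_matrix_vector cinner_scaleR_right complex_nonneg_Reals_iff)

lemma psd_sandwich: "psd X \<Longrightarrow> psd (adjoint_op A ** X ** A)"
  unfolding psd_def by (simp add: matrix_vector_mul_assoc[symmetric] cinner_adjoint[of _ "adjoint_op A"])

lemma psd_adjoint_mult: "psd (adjoint_op A ** A)"
  using psd_sandwich[OF psd_mat_1, of A] by simp

text \<open>A zero of a nonnegative form is a minimum; if \<open>M *v x\<close> were nonzero, a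
  small step from \<open>x\<close> against it would make the form negative.\<close>

lemma psd_kernel:
  assumes "psd M" "cinner x (M *v x) = 0"
  shows "M *v x = 0"
proof (rule ccontr)
  assume "M *v x \<noteq> 0"
  define y where "y = M *v x"
  define q where "q = Re (cinner y (M *v y))"
  have n: "(norm y)\<^sup>2 > 0" and q: "q \<ge> 0"
    using \<open>M *v x \<noteq> 0\<close> psd_quadratic_form_nonneg[OF assms(1)] by (simp_all add: y_def q_def)
  \<comment> \<open>A step small enough for the linear decrease to beat the quadratic term; the
    \<open>+ 1\<close> keeps the quotient positive and defined when \<open>q = 0\<close>.\<close>
  define t where "t = (norm y)\<^sup>2 / (q + 1)"
  have t: "t > 0" and tq: "t * q < (norm y)\<^sup>2"
    using n q by (auto simp: t_def field_simps mult_less_cancel_left)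
  have "cinner x (M *v y) = cinner y y"
    using cinner_adjoint[of x M y] psd_hermitian[OF assms(1)] by (simp add: y_def)
  then have "cinner (x + c *s y) (M *v (x + c *s y))
      = (c + cnj c) * cinner y y + cnj c * c * cinner y (M *v y)" for c
    using assms(2) by (simp add: matrix_vector_right_distrib matrix_vector_scale cinner_add_left cinner_add_right
          cinner_scale_left cinner_scale_right algebra_simps flip: y_def)
  from this[of "of_real (- t)"]
  have "Re (cinner (x + of_real (- t) *s y) (M *v (x + of_real (- t) *s y))) = - 2 * t * (norm y)\<^sup>2 + t * t * q"
    by (simp only: cinner_self) (simp add: q_def del: of_real_power)
  then have "0 \<le> - 2 * t * (norm y)\<^sup>2 + t * t * q"
    using psd_quadratic_form_nonneg[OF assms(1), of "x + of_real (- t) *s y"] by simp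
  then have "0 \<le> t * (t * q - 2 * (norm y)\<^sup>2)"
    by (simp add: algebra_simps)
  with t have "0 \<le> t * q - 2 * (norm y)\<^sup>2"
    by (simp add: zero_le_mult_iff)
  with tq n show False by linarith
qed

lemma trace_adjoint_sandwich:
  "trace (adjoint_op D ** Y ** D) = (\<Sum>i\<in>UNIV. cinner (column i D) (Y *v column i D))"
proof -
  have "(adjoint_op D ** (Y ** D)) $ i $ i = cinner (column i D) (Y *v column i D)" for i
    by (simp add: matrix_matrix_mult_def cinner_def column_def matrix_vector_mult_def)
  then show ?thesis by (simp add: trace_def matrix_mul_assoc)
qed

lemma trace_psd_nonneg:
  assumes "psd X"
  shows "trace X \<in> \<real>\<^sub>\<ge>\<^sub>0"
proof -
  have "trace X = (\<Sum>i\<in>UNIV. cinner (column i (mat 1)) (X *v column i (mat 1)))"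
    using trace_adjoint_sandwich[of "mat 1" X] by simp
  also have "\<dots> \<in> \<real>\<^sub>\<ge>\<^sub>0"
    using assms by (simp add: psd_def complex_nonneg_Reals_iff sum_nonneg)
  finally show ?thesis .
qed

text \<open>The trace is a sum of nonnegative forms over the columns of \<open>D\<close>, so each
  form vanishes and \<open>psd_kernel\<close> annihilates each column. This equality case yields
  uniqueness both of square roots and of the projection.\<close>

lemma trace_sandwich_eq_0:
  assumes "psd Y" "Re (trace (adjoint_op D ** Y ** D)) = 0"
  shows "Y ** D = 0"
proof -
  have "Re (cinner (column i D) (Y *v column i D)) = 0" for i
    using assms(2) psd_quadratic_form_nonneg[OF assms(1)]
    by (simp add: trace_adjoint_sandwich sum_nonneg_eq_0_iff)
  then have "cinner (column i D) (Y *v column i D) = 0" for i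
    using assms(1) by (simp add: psd_def complex_nonneg_Reals_iff complex_eq_iff)
  then have "Y *v column i D = 0" for i
    by (rule psd_kernel[OF assms(1)])
  then show ?thesis
    by (simp add: vec_eq_iff matrix_matrix_mult_def matrix_vector_mult_def column_def)
qed

subsection \<open>Square roots and polar decomposition\<close>

text \<open>No commutation of \<open>Y\<close> and \<open>Z\<close> is available. Instead
  \<open>Y ** D + D ** Z\<close> telescopes to the difference of the squares; multiplying by
  \<open>D\<close> and taking traces gives two nonnegative terms with sum 0, so both
  \<open>Y\<close> and \<open>Z\<close> annihilate \<open>D\<close>, and then so does
  \<open>D\<close>.\<close>

lemma op_sqrt_unique:
  assumes "psd Y" "psd Z" "Y ** Y = Z ** Z"
  shows "Y = Z"
proof -
  define D where "D = Y - Z"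
  have D: "adjoint_op D = D"
    using assms by (simp add: D_def adjoint_op_diff psd_hermitian)
  have "Y ** D + D ** Z = 0"
    using assms(3) by (simp add: D_def matrix_mult_diff_left matrix_mult_diff_right)
  then have "D ** Y ** D + D ** D ** Z = 0"
    using matrix_mult_add_right[of D "Y ** D" "D ** Z"] by (simp add: matrix_mul_assoc)
  then have "trace (D ** Y ** D) + trace (D ** D ** Z) = 0"
    by (metis trace_add trace_0 mat_0)
  moreover have "trace (D ** D ** Z) = trace (D ** Z ** D)"
    by (metis matrix_mul_assoc trace_mul_sym)
  ultimately have "Re (trace (D ** Y ** D)) + Re (trace (D ** Z ** D)) = 0"
    by (metis plus_complex.sel(1) zero_complex.sel(1))
  moreover have "Re (trace (D ** Y ** D)) \<ge> 0" "Re (trace (D ** Z ** D)) \<ge> 0"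
    using trace_psd_nonneg[OF psd_sandwich[of _ D]] assms
    by (simp_all add: complex_nonneg_Reals_iff D)
  ultimately have "Y ** D = 0" "Z ** D = 0"
    using trace_sandwich_eq_0[OF assms(1), of D] trace_sandwich_eq_0[OF assms(2), of D] by (simp_all add: D)
  then have "D ** D = 0"
    unfolding D_def by (metis matrix_mult_diff_left diff_self)
  then have "norm D = 0"
    using norm_operator_squared[of D] by (simp add: D trace_0[unfolded mat_0])
  then show ?thesis by (simp add: D_def)
qed

section \<open>Rank-one operators\<close>

lemma ketbra_vec: "ketbra v *v y = cinner v y *s v"
  by (simp add: vec_eq_iff cinner_def ketbra_def matrix_vector_mult_def sum_distrib_left sum_distrib_right
      mult.assoc mult.left_commute mult.commute)

lemma cinner_ketbra: "cinner x (ketbra v *v y) = cinner x v * cinner v y"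
  by (simp add: ketbra_vec cinner_scale_right mult.commute)

lemma adjoint_op_ketbra [simp]: "adjoint_op (ketbra v) = ketbra v"
  by (simp add: vec_eq_iff ketbra_def mult.commute)

lemma psd_ketbra: "psd (ketbra v)"
proof (rule psdI_hermitian)
  fix x
  show "0 \<le> Re (cinner x (ketbra v *v x))"
    using cinner_commute[of v x] by (simp add: cinner_ketbra)
qed simp

section \<open>Continuity of the matrix operations\<close>

lemma continuous_on_cinner [continuous_intros]:
  "continuous_on S f \<Longrightarrow> continuous_on S g \<Longrightarrow> continuous_on S (\<lambda>x. cinner (f x) (g x))"
  unfolding cinner_def by (intro continuous_intros)

lemma continuous_on_matrix_vector [continuous_intros]:
  fixes f :: "'z::topological_space \<Rightarrow> 'n::finite operator"
  shows "continuous_on S f \<Longrightarrow> continuous_on S g \<Longrightarrow> continuous_on S (\<lambda>x. f x *v g x)"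
  unfolding matrix_vector_mult_def by (intro continuous_intros continuous_on_vec_lambda)

lemma continuous_on_matrix_mult [continuous_intros]:
  fixes f :: "'z::topological_space \<Rightarrow> 'n::finite operator"
  shows "continuous_on S f \<Longrightarrow> continuous_on S g \<Longrightarrow> continuous_on S (\<lambda>x. f x ** g x)"
  unfolding matrix_matrix_mult_def by (intro continuous_intros continuous_on_vec_lambda)

lemma continuous_on_adjoint_op [continuous_intros]:
  fixes f :: "'z::topological_space \<Rightarrow> 'n::finite operator"
  assumes "continuous_on S f"
  shows "continuous_on S (\<lambda>x. adjoint_op (f x))"
proof -
  have "adjoint_op (f x) = (\<chi> i j. cnj (f x $ j $ i))" for x
    by (simp add: vec_eq_iff)
  then show ?thesis
    by (simp only:) (intro continuous_intros continuous_on_vec_lambda assms)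
qed

lemma continuous_on_trace [continuous_intros]:
  fixes f :: "'z::topological_space \<Rightarrow> 'n::finite operator"
  shows "continuous_on S f \<Longrightarrow> continuous_on S (\<lambda>x. trace (f x))"
  unfolding trace_def by (intro continuous_intros)

text \<open>The eigenvector is a maximizer of the Rayleigh quotient.\<close>

lemma psd_eigenvector:
  fixes X :: "'n::finite operator"
  assumes "psd X"
  obtains v l where "norm v = 1" "l \<ge> 0" "X *v v = l *\<^sub>R v" "psd (X - l *\<^sub>R ketbra v)"
    "X \<noteq> 0 \<longrightarrow> l > 0"
proof -
  let ?q = "\<lambda>x. Re (cinner x (X *v x))"
  have "continuous_on (sphere 0 1) ?q"
    by (intro continuous_intros)
  moreover have "axis undefined 1 \<in> sphere (0 :: complex ^ 'n) 1"
    by (simp add: norm_eq_sqrt_inner inner_axis_axis)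
  ultimately obtain v where v: "v \<in> sphere 0 1" and max: "\<And>y. y \<in> sphere 0 1 \<Longrightarrow> ?q y \<le> ?q v"
    using continuous_attains_sup[OF compact_sphere, of 0 1 ?q] by blast
  define l where "l = ?q v"
  have l: "l \<ge> 0" by (simp add: l_def psd_quadratic_form_nonneg assms)
  have le: "?q x \<le> l * (norm x)\<^sup>2" for x
  proof (cases "x = 0")
    case False
    define c where "c = complex_of_real (inverse (norm x))"
    have "norm (c *s x) = 1"
    proof -
      have "c *s x = inverse (norm x) *\<^sub>R x"
        by (simp add: c_def vec_eq_iff scaleR_conv_of_real[where 'a=complex])
      with False show ?thesis by simp
    qed
    then have "?q (c *s x) \<le> l"
      using max[of "c *s x"] by (simp add: l_def)
    moreover have "?q (c *s x) = (inverse (norm x))\<^sup>2 * ?q x"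
      by (simp add: c_def matrix_vector_scale cinner_scale_left cinner_scale_right power2_eq_square divide_simps)
    ultimately show ?thesis
      using False by (simp add: field_simps)
  qed simp
  \<comment> \<open>Maximality of \<open>l\<close> says that this operator is positive semidefinite
    with a vanishing form at \<open>v\<close>; \<open>psd_kernel\<close> then gives the eigenvalue
    equation without differentiating the Rayleigh quotient.\<close>
  have psd: "psd (l *\<^sub>R mat 1 - X)"
  proof (rule psdI_hermitian)
    show "adjoint_op (l *\<^sub>R mat 1 - X) = l *\<^sub>R mat 1 - X"
      by (simp add: adjoint_op_diff adjoint_op_scaleR psd_hermitian assms)
    show "0 \<le> Re (cinner x ((l *\<^sub>R mat 1 - X) *v x))" for x
      using le[of x]
      by (simp add: matrix_vector_mult_diff_rdistrib scaleR_matrix_vector cinner_diff_right cinner_scaleR_right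
          cinner_self)
  qed
  have nv: "norm v = 1" using v by simp
  have "Im (cinner v (X *v v)) = 0"
    using assms by (simp add: psd_def complex_nonneg_Reals_iff)
  then have "cinner v ((l *\<^sub>R mat 1 - X) *v v) = 0"
    using nv by (simp add: matrix_vector_mult_diff_rdistrib scaleR_matrix_vector cinner_diff_right
          cinner_scaleR_right cinner_self complex_eq_iff l_def)
  from psd_kernel[OF psd this] have eig: "X *v v = l *\<^sub>R v"
    by (simp add: matrix_vector_mult_diff_rdistrib scaleR_matrix_vector)
  have "psd (X - l *\<^sub>R ketbra v)"
  proof (rule psdI_hermitian)
    show "adjoint_op (X - l *\<^sub>R ketbra v) = X - l *\<^sub>R ketbra v"
      by (simp add: adjoint_op_diff adjoint_op_scaleR psd_hermitian assms)
    fix x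
    define c where "c = cinner v x"
    \<comment> \<open>The component of \<open>x\<close> orthogonal to \<open>v\<close>: the form of
      \<open>X\<close> there is the deflated form at \<open>x\<close>.\<close>
    define y where "y = x + (- c) *s v"
    have vv: "cinner v v = 1" using nv by (simp add: cinner_self)
    have vX: "cinner v (X *v z) = l *\<^sub>R cinner v z" for z
      using cinner_adjoint[of v X z] eig cinner_commute[of "X *v v" z] cinner_commute[of v z]
      by (simp add: psd_hermitian assms cinner_scaleR_right)
    have xv: "cinner x v = cnj c" by (simp add: c_def cinner_commute[of x v])
    have "cinner y (X *v y) = cinner x (X *v x) - l *\<^sub>R (cnj c * c)"
      unfolding y_def
      by (simp only: matrix_vector_right_distrib matrix_vector_scale cinner_add_left cinner_add_right
          cinner_scale_left cinner_scale_right eig vX cinner_scaleR_right vv xv)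
         (simp add: c_def scaleR_conv_of_real algebra_simps)
    also have "\<dots> = cinner x ((X - l *\<^sub>R ketbra v) *v x)"
      by (simp add: matrix_vector_mult_diff_rdistrib scaleR_matrix_vector cinner_diff_right
          cinner_scaleR_right cinner_ketbra xv c_def)
    finally show "0 \<le> Re (cinner x ((X - l *\<^sub>R ketbra v) *v x))"
      using psd_quadratic_form_nonneg[OF assms, of y] by simp
  qed
  moreover have "l > 0" if "X \<noteq> 0"
  proof (rule ccontr)
    assume "\<not> l > 0"
    with l have "l = 0" by simp
    with le psd_quadratic_form_nonneg[OF assms] have "?q x = 0" for x
      by (metis antisym mult_zero_left)
    then have "cinner x (X *v x) = 0" for x
      using assms by (simp add: psd_def complex_nonneg_Reals_iff complex_eq_iff)
    with that quadratic_form_zero show False by blast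
  qed
  ultimately show ?thesis
    using that nv l eig by blast
qed

text \<open>Deflation: subtracting an eigencomponent enlarges the kernel.\<close>

lemma psd_sqrt_exists:
  fixes X :: "'n::finite operator"
  assumes "psd X"
  shows "\<exists>Y. psd Y \<and> Y ** Y = X"
  using assms
proof (induction "DIM(complex ^ 'n) - dim {x. X *v x = 0}" arbitrary: X rule: less_induct)
  case less
  show ?case
  proof (cases "X = 0")
    case True
    then show ?thesis by (intro exI[of _ 0]) simp
  next
    case False
    obtain v l where v: "norm v = 1" and l: "l \<ge> 0" and eig: "X *v v = l *\<^sub>R v"
      and psd: "psd (X - l *\<^sub>R ketbra v)" and l0: "l > 0"
      using psd_eigenvector[OF less.prems] False by metis
    define X' where "X' = X - l *\<^sub>R ketbra v"
    have vv: "cinner v v = 1" using v by (simp add: cinner_self)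
    have X'v: "X' *v v = 0"
      by (simp add: X'_def matrix_vector_mult_diff_rdistrib scaleR_matrix_vector ketbra_vec vv eig)
    have sub: "subspace {x. M *v x = 0}" for M :: "'n operator"
      by (auto simp: subspace_def matrix_vector_right_distrib matrix_vector_scaleR)
    \<comment> \<open>Since \<open>X\<close> is Hermitian and \<open>l\<close> is nonzero, its
      kernel is orthogonal to \<open>v\<close>, so deflation preserves it; \<open>v\<close> itself
      is a new kernel vector.\<close>
    have "X' *v x = 0" if "X *v x = 0" for x
    proof -
      have "l *\<^sub>R cinner v x = cinner v (X *v x)"
        using cinner_adjoint[of v X x] eig cinner_commute[of "X *v v" x] cinner_commute[of v x]
        by (simp add: psd_hermitian less.prems cinner_scaleR_right)
      with that l0 have "cinner v x = 0" by simp
      with that show ?thesis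
        by (simp add: X'_def matrix_vector_mult_diff_rdistrib scaleR_matrix_vector ketbra_vec)
    qed
    moreover have "X *v v \<noteq> 0" using eig l0 v by auto
    ultimately have "{x. X *v x = 0} \<subset> {x. X' *v x = 0}"
      using X'v by blast
    then have "dim {x. X *v x = 0} < dim {x. X' *v x = 0}"
      by (intro dim_psubset) (simp add: span_eq_iff[THEN iffD2, OF sub])
    then have "DIM(complex ^ 'n) - dim {x. X' *v x = 0} < DIM(complex ^ 'n) - dim {x. X *v x = 0}"
      using dim_subset_UNIV[of "{x. X' *v x = 0}"] by linarith
    from less.hyps[OF this] psd obtain Y where Y: "psd Y" "Y ** Y = X'"
      by (auto simp: X'_def)
    have hY: "adjoint_op Y = Y" using Y by (simp add: psd_hermitian)
    \<comment> \<open>The root of \<open>X'\<close> annihilates \<open>v\<close> as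
      \<open>X'\<close> does, so it is orthogonal to \<open>ketbra v\<close> and the square of the
      sum below has no cross terms.\<close>
    have "Y *v v = 0"
    proof -
      have "cinner (Y *v v) (Y *v v) = cinner v (X' *v v)"
        using cinner_adjoint[of v Y "Y *v v"] hY by (simp add: Y(2)[symmetric] matrix_vector_mul_assoc[symmetric])
      then show ?thesis by (simp add: X'v cinner_self)
    qed
    have "Y ** ketbra v = 0"
      by (simp add: matrix_eq matrix_vector_mul_assoc[symmetric] ketbra_vec matrix_vector_scale \<open>Y *v v = 0\<close>)
    moreover from this have "ketbra v ** Y = 0"
      by (metis adjoint_op_adjoint_op adjoint_op_ketbra adjoint_op_mult hY psd_0 psd_hermitian)
    moreover have "ketbra v ** ketbra v = ketbra v"
      by (simp add: matrix_eq matrix_vector_mul_assoc[symmetric] ketbra_vec matrix_vector_scale vv)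
    ultimately have "(Y + sqrt l *\<^sub>R ketbra v) ** (Y + sqrt l *\<^sub>R ketbra v) = X"
      using l Y(2) by (simp add: matrix_mult_add_left matrix_mult_add_right scaleR_matrix_mult matrix_mult_scaleR X'_def)
    moreover have "psd (Y + sqrt l *\<^sub>R ketbra v)"
      using Y l by (intro psd_add psd_scaleR psd_ketbra) auto
    ultimately show ?thesis by blast
  qed
qed

lemma op_sqrt_eqI:
  assumes "psd Y" "Y ** Y = X"
  shows "op_sqrt X = Y"
  unfolding op_sqrt_def using assms by (intro the_equality) (auto intro: op_sqrt_unique)

lemma
  assumes "psd X"
  shows psd_op_sqrt: "psd (op_sqrt X)" and op_sqrt_mult_self: "op_sqrt X ** op_sqrt X = X"
proof -
  obtain Y where "psd Y" "Y ** Y = X"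
    using psd_sqrt_exists[OF assms] by blast
  then show "psd (op_sqrt X)" "op_sqrt X ** op_sqrt X = X"
    by (simp_all add: op_sqrt_eqI)
qed

lemma adjoint_op_sqrt: "psd X \<Longrightarrow> adjoint_op (op_sqrt X) = op_sqrt X"
  by (simp add: psd_op_sqrt psd_hermitian)

section \<open>Unitaries and the polar decomposition\<close>

definition unitary :: "'n::finite operator \<Rightarrow> bool" where
  "unitary U \<longleftrightarrow> adjoint_op U ** U = mat 1"

lemma unitary_right: "unitary U \<Longrightarrow> U ** adjoint_op U = mat 1"
  unfolding unitary_def by (simp add: matrix_left_right_inverse)

lemma unitary_adjoint: "unitary U \<Longrightarrow> unitary (adjoint_op U)"
  by (simp add: unitary_def unitary_right)

lemma unitary_mult: "unitary U \<Longrightarrow> unitary V \<Longrightarrow> unitary (U ** V)"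
  unfolding unitary_def adjoint_op_mult by (metis matrix_mul_assoc matrix_mul_lid)

lemma norm_mult_unitary:
  fixes X :: "'n::finite operator"
  assumes "unitary U"
  shows "norm (X ** U) = norm X"
proof -
  have "trace (adjoint_op U ** (adjoint_op X ** X ** U)) = trace (adjoint_op X ** X ** U ** adjoint_op U)"
    by (rule trace_mul_sym)
  then have "(norm (X ** U))\<^sup>2 = (norm X)\<^sup>2"
    using unitary_right[OF assms]
    by (simp add: norm_operator_squared adjoint_op_mult matrix_mul_assoc)
      (simp flip: matrix_mul_assoc)
  then show ?thesis by simp
qed

text \<open>All unitaries have the same Frobenius norm. Compactness supplies the maximizer from
  which the polar decomposition is read off.\<close>

lemma compact_unitary: "compact {U :: 'n::finite operator. unitary U}"
proof -
  have "norm U \<le> sqrt (real CARD('n))" if "unitary U" for U :: "'n operator"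
    using norm_operator_squared[of U] that by (simp add: unitary_def trace_I real_le_rsqrt)
  then have "bounded {U :: 'n operator. unitary U}"
    by (auto simp: bounded_iff)
  moreover have "closed {U :: 'n operator. unitary U}"
    unfolding unitary_def by (intro closed_Collect_eq continuous_intros)
  ultimately show ?thesis by (simp add: compact_eq_bounded_closed)
qed

lemma complex_scale_matrix_vector: "map_matrix ((*) c) X *v x = c *s (X *v x)"
  by (simp add: vec_eq_iff map_matrix_def matrix_vector_mult_def sum_distrib_left mult.assoc)

lemma trace_complex_scale: "trace (map_matrix ((*) c) X) = c * trace X"
  by (simp add: trace_def map_matrix_def sum_distrib_left)

lemma trace_ketbra_mult: "trace (ketbra v ** M) = cinner v (M *v v)"
proof -
  have "trace (ketbra v ** M) = (\<Sum>i\<in>UNIV. \<Sum>j\<in>UNIV. v $ i * cnj (v $ j) * M $ j $ i)"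
    by (simp add: trace_def matrix_matrix_mult_def ketbra_def)
  also have "\<dots> = (\<Sum>j\<in>UNIV. \<Sum>i\<in>UNIV. v $ i * cnj (v $ j) * M $ j $ i)"
    by (rule sum.swap)
  finally show ?thesis
    by (simp add: cinner_def matrix_vector_mult_def sum_distrib_left mult_ac)
qed

text \<open>The operator multiplies \<open>v\<close> by the phase \<open>c\<close> and fixes its
  orthogonal complement. It is the perturbation applied to the maximizer in the polar
  decomposition.\<close>

lemma unitary_rank_one_update:
  assumes "norm v = 1" "norm c = 1"
  shows "unitary (mat 1 + map_matrix ((*) (c - 1)) (ketbra v))"
proof -
  have vv: "cinner v v = 1" using assms by (simp add: cinner_self)
  have mv: "map_matrix ((*) d) (ketbra v) *v x = (d * cinner v x) *s v" for d x
    by (simp add: complex_scale_matrix_vector ketbra_vec)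
  have adj: "adjoint_op (map_matrix ((*) d) (ketbra v)) = map_matrix ((*) (cnj d)) (ketbra v)" for d
    by (simp add: vec_eq_iff map_matrix_def ketbra_def mult.commute)
  have "cnj c * c = 1"
    using assms(2) complex_norm_square[of c] by (simp add: mult.commute)
  then have "cnj (c - 1) + (c - 1) + cnj (c - 1) * (c - 1) = 0"
    by (simp add: algebra_simps)
  then have "(c - 1) + (cnj (c - 1) + cnj (c - 1) * (c - 1)) = 0"
    by (simp add: algebra_simps)
  then have z: "(c - 1) * z + cnj (c - 1) * (z + (c - 1) * z) = 0" for z
  proof -
    have "(c - 1) * z + cnj (c - 1) * (z + (c - 1) * z) = ((c - 1) + (cnj (c - 1) + cnj (c - 1) * (c - 1))) * z"
      by (simp only: distrib_left distrib_right mult_ac)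
    with \<open>(c - 1) + (cnj (c - 1) + cnj (c - 1) * (c - 1)) = 0\<close> show ?thesis by simp
  qed
  have "(adjoint_op (mat 1 + map_matrix ((*) (c - 1)) (ketbra v)) ** (mat 1 + map_matrix ((*) (c - 1)) (ketbra v))) *v x
     = mat 1 *v x" for x
    unfolding adjoint_op_add adj adjoint_op_mat_1 matrix_vector_mul_assoc[symmetric] matrix_vector_mult_add_rdistrib
      mv cinner_add_right cinner_scale_right vv matrix_vector_mul_lid
    using z by (simp add: add.assoc flip: vector_sadd_rdistrib)
  then show ?thesis
    unfolding unitary_def matrix_eq by blast
qed

text \<open>The unitary is a maximizer of \<open>Re (trace (U X))\<close>; perturbing it in a single direction
  \<open>v\<close> by a phase shows that the quadratic form of \<open>U X\<close> at \<open>v\<close> is nonnegative.\<close>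

lemma polar_decomposition:
  fixes X :: "'n::finite operator"
  obtains U where "unitary U" "psd (U ** X)"
proof -
  have "unitary (mat 1 :: 'n operator)" by (simp add: unitary_def)
  moreover have "continuous_on {U :: 'n operator. unitary U} (\<lambda>U. Re (trace (U ** X)))"
    by (intro continuous_intros)
  ultimately obtain U where U: "unitary U" and
    max: "\<And>V. unitary V \<Longrightarrow> Re (trace (V ** X)) \<le> Re (trace (U ** X))"
    using continuous_attains_sup[OF compact_unitary, of "\<lambda>U. Re (trace (U ** X))"] by auto
  define M where "M = U ** X"
  have unit: "cinner v (M *v v) \<in> \<real>\<^sub>\<ge>\<^sub>0" if v: "norm v = 1" for v
  proof -
    let ?z = "cinner v (M *v v)"
    have tr: "trace (map_matrix ((*) d) (ketbra v) ** M) = d * ?z" for d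
    proof -
      have "map_matrix ((*) d) (ketbra v) ** M = map_matrix ((*) d) (ketbra v ** M)"
        by (simp add: vec_eq_iff map_matrix_def matrix_matrix_mult_def sum_distrib_left mult.assoc)
      then show ?thesis by (simp add: trace_complex_scale trace_ketbra_mult)
    qed
    \<comment> \<open>The rank-one update changes the trace by exactly \<open>(c - 1) * ?z\<close>,
      which maximality of \<open>U\<close> makes nonpositive in real part.\<close>
    have phase: "Re ((c - 1) * ?z) \<le> 0" if "norm c = 1" for c
    proof -
      have "unitary ((mat 1 + map_matrix ((*) (c - 1)) (ketbra v)) ** U)"
        using unitary_rank_one_update[OF v that] U unitary_mult by blast
      from max[OF this] have "Re (trace ((mat 1 + map_matrix ((*) (c - 1)) (ketbra v)) ** M)) \<le> Re (trace M)"
        by (simp add: M_def matrix_mul_assoc)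
      then show ?thesis
        by (simp add: matrix_mult_add_left trace_add tr)
    qed
    have "norm ?z \<le> Re ?z"
    proof (cases "?z = 0")
      case False
      \<comment> \<open>The phase that rotates \<open>?z\<close> onto the positive real axis; the
        inequality then reads \<open>norm ?z \<le> Re ?z\<close>.\<close>
      define c where "c = cnj ?z / of_real (norm ?z)"
      have "norm c = 1" using False by (simp add: c_def norm_divide)
      moreover have "c * ?z = of_real (norm ?z)"
        using False complex_norm_square[of ?z] by (simp add: c_def power2_eq_square field_simps)
      ultimately show ?thesis
        using phase[of c] by (simp add: left_diff_distrib)
    qed simp
    then show ?thesis
      using abs_Re_le_cmod[of ?z] cmod_power2[of ?z]
      by (simp add: complex_nonneg_Reals_iff)
        (smt (verit) complex_Re_le_cmod norm_ge_zero power2_eq_iff zero_eq_power2)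
  qed
  have "psd M"
    unfolding psd_def
  proof
    fix x
    show "cinner x (M *v x) \<in> \<real>\<^sub>\<ge>\<^sub>0"
    proof (cases "x = 0")
      case False
      have "of_real (norm x) *s (inverse (norm x) *\<^sub>R x) = x"
        using False by (simp add: vec_eq_iff scaleR_conv_of_real[where 'a=complex])
      moreover obtain v where v: "v = inverse (norm x) *\<^sub>R x" "norm v = 1"
        using False by simp
      ultimately have "cinner x (M *v x) = of_real ((norm x)\<^sup>2) * cinner v (M *v v)"
        by (metis (no_types, lifting) cinner_scale_left cinner_scale_right complex_cnj_complex_of_real
            matrix_vector_scale mult.assoc of_real_power power2_eq_square)
      then show ?thesis
        using unit[OF v(2)] by (simp add: complex_nonneg_Reals_iff)
    qed simp
  qed
  then show ?thesis using that U by (simp add: M_def)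
qed

text \<open>Being Hermitian, \<open>U ** X\<close> squares to \<open>adjoint_op X ** X\<close>
  because \<open>U\<close> cancels, and uniqueness of the root identifies it as the absolute value
  of \<open>X\<close>.\<close>

lemma polar_abs:
  fixes X :: "'n::finite operator"
  obtains U where "unitary U" "U ** X = op_sqrt (adjoint_op X ** X)"
proof -
  obtain U where U: "unitary U" "psd (U ** X)" by (rule polar_decomposition)
  have "(U ** X) ** (U ** X) = adjoint_op (U ** X) ** (U ** X)"
    using psd_hermitian[OF U(2)] by simp
  also have "\<dots> = adjoint_op X ** X"
    using U(1) unfolding adjoint_op_mult unitary_def by (metis matrix_mul_assoc matrix_mul_lid)
  finally show ?thesis using that U op_sqrt_eqI by metis
qed

text \<open>With \<open>S\<close> the root of \<open>P\<close>, this is the Cauchy-Schwarz bound for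
  \<open>S\<close> and \<open>S ** U\<close>, which have equal Frobenius norm.\<close>

lemma trace_psd_unitary_le:
  assumes "psd P" "unitary U"
  shows "Re (trace (P ** U)) \<le> Re (trace P)"
proof -
  let ?S = "op_sqrt P"
  have S: "adjoint_op ?S = ?S" "?S ** ?S = P"
    using assms(1) by (simp_all add: adjoint_op_sqrt op_sqrt_mult_self)
  have "2 * (?S \<bullet> (?S ** U)) \<le> (norm ?S)\<^sup>2 + (norm (?S ** U))\<^sup>2"
    using zero_le_power2[of "norm (?S - ?S ** U)"] by (simp add: power2_norm_eq_inner algebra_simps inner_commute)
  then have "?S \<bullet> (?S ** U) \<le> (norm ?S)\<^sup>2"
    by (simp add: norm_mult_unitary[OF assms(2)])
  then show ?thesis
    by (simp add: inner_operator norm_operator_squared S matrix_mul_assoc)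
qed

subsection \<open>Fidelity and the Bures distance\<close>

text \<open>The polar form of \<open>adjoint_op B\<close> has absolute value
  \<open>op_sqrt \<sigma>\<close>. This is the unitary freedom of purifications, stated for matrix
  factors.\<close>

lemma square_root_unitary:
  assumes "psd \<sigma>" "B ** adjoint_op B = \<sigma>"
  obtains V where "unitary V" "B = op_sqrt \<sigma> ** V"
proof -
  obtain U where U: "unitary U" "U ** adjoint_op B = op_sqrt \<sigma>"
    using polar_abs[of "adjoint_op B"] assms(2) by auto
  have "B ** adjoint_op U = op_sqrt \<sigma>"
    by (metis U(2) adjoint_op_adjoint_op adjoint_op_mult adjoint_op_sqrt assms(1))
  then have "B = op_sqrt \<sigma> ** U"
    using U(1) unfolding unitary_def by (metis matrix_mul_assoc matrix_mul_rid)
  with U(1) that show ?thesis by blast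
qed

text \<open>Uhlmann's theorem, with square roots of \<open>\<sigma>\<close> in the role of purifications.\<close>

lemma inner_le_fidelity:
  assumes "psd \<rho>" "psd \<sigma>" "B ** adjoint_op B = \<sigma>"
  shows "op_sqrt \<rho> \<bullet> B \<le> fidelity \<rho> \<sigma>"
proof -
  let ?X = "op_sqrt \<rho> ** op_sqrt \<sigma>"
  obtain V where V: "unitary V" "B = op_sqrt \<sigma> ** V"
    using square_root_unitary assms by metis
  obtain U where U: "unitary U" "U ** ?X = op_sqrt (adjoint_op ?X ** ?X)"
    by (rule polar_abs)
  have "op_sqrt \<rho> \<bullet> B = Re (trace (?X ** V))"
    by (simp add: inner_operator adjoint_op_sqrt assms V(2) matrix_mul_assoc)
  \<comment> \<open>Writing \<open>?X\<close> in polar form and cycling the trace leaves the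
    absolute value of \<open>?X\<close> times a single unitary.\<close>
  also have "?X ** V = adjoint_op U ** op_sqrt (adjoint_op ?X ** ?X) ** V"
    using U unfolding unitary_def by (metis matrix_mul_assoc matrix_mul_lid)
  also have "trace \<dots> = trace (op_sqrt (adjoint_op ?X ** ?X) ** (V ** adjoint_op U))"
    by (metis matrix_mul_assoc trace_mul_sym)
  also have "Re \<dots> \<le> fidelity \<rho> \<sigma>"
    unfolding fidelity_def trace_norm_def
    by (intro trace_psd_unitary_le psd_op_sqrt psd_adjoint_mult unitary_mult unitary_adjoint U V)
  finally show ?thesis .
qed

text \<open>The polar unitary of \<open>op_sqrt \<rho> ** op_sqrt \<sigma>\<close> turns the overlap
  into the trace norm.\<close>

lemma fidelity_attained:
  assumes "psd \<rho>" "psd \<sigma>"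
  obtains V where "unitary V" "op_sqrt \<rho> \<bullet> (op_sqrt \<sigma> ** V) = fidelity \<rho> \<sigma>"
proof -
  let ?X = "op_sqrt \<rho> ** op_sqrt \<sigma>"
  obtain U where U: "unitary U" "U ** ?X = op_sqrt (adjoint_op ?X ** ?X)"
    by (rule polar_abs)
  have "op_sqrt \<rho> \<bullet> (op_sqrt \<sigma> ** U) = Re (trace (?X ** U))"
    by (simp add: inner_operator adjoint_op_sqrt assms matrix_mul_assoc)
  also have "\<dots> = fidelity \<rho> \<sigma>"
    by (metis U(2) fidelity_def trace_mul_sym trace_norm_def)
  finally show ?thesis using that U(1) by blast
qed

lemma sqrt_unitary_mult_adjoint:
  assumes "psd \<sigma>" "unitary V"
  shows "(op_sqrt \<sigma> ** V) ** adjoint_op (op_sqrt \<sigma> ** V) = \<sigma>"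
  unfolding adjoint_op_mult adjoint_op_sqrt[OF assms(1)]
  by (metis assms matrix_mul_assoc matrix_mul_rid op_sqrt_mult_self unitary_right)

text \<open>The real part of a trace is invariant under adjoints, so an optimal \<open>V\<close> for
  one order makes \<open>adjoint_op V\<close> admissible for the other.\<close>

lemma fidelity_sym:
  assumes "psd \<rho>" "psd \<sigma>"
  shows "fidelity \<rho> \<sigma> = fidelity \<sigma> \<rho>"
proof -
  have "fidelity \<rho> \<sigma> \<le> fidelity \<sigma> \<rho>" if "psd \<rho>" "psd \<sigma>" for \<rho> \<sigma> :: "'a operator"
  proof -
    obtain V where V: "unitary V" "op_sqrt \<rho> \<bullet> (op_sqrt \<sigma> ** V) = fidelity \<rho> \<sigma>"
      using fidelity_attained \<open>psd \<rho>\<close> \<open>psd \<sigma>\<close> by blast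
    have "op_sqrt \<rho> \<bullet> (op_sqrt \<sigma> ** V) = Re (trace (op_sqrt \<rho> ** op_sqrt \<sigma> ** V))"
      by (simp add: inner_operator adjoint_op_sqrt that matrix_mul_assoc)
    also have "\<dots> = Re (trace (adjoint_op V ** (op_sqrt \<sigma> ** op_sqrt \<rho>)))"
      using trace_adjoint_op[of "op_sqrt \<rho> ** op_sqrt \<sigma> ** V"]
      by (simp add: adjoint_op_mult adjoint_op_sqrt that)
    also have "\<dots> = op_sqrt \<sigma> \<bullet> (op_sqrt \<rho> ** adjoint_op V)"
      by (simp add: inner_operator adjoint_op_sqrt that trace_mul_sym[of "adjoint_op V"] matrix_mul_assoc[symmetric])
    also have "\<dots> \<le> fidelity \<sigma> \<rho>"
      using that V(1) by (intro inner_le_fidelity sqrt_unitary_mult_adjoint unitary_adjoint)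
    finally show ?thesis using V(2) by simp
  qed
  with assms show ?thesis by (meson antisym)
qed

lemma fidelity_nonneg: "0 \<le> fidelity \<rho> \<sigma>"
  unfolding fidelity_def trace_norm_def
  using trace_psd_nonneg[OF psd_op_sqrt[OF psd_adjoint_mult]] unfolding complex_nonneg_Reals_iff by blast

lemma density_ops_psd: "\<rho> \<in> density_ops \<Longrightarrow> psd \<rho>"
  by (simp add: density_ops_def)

lemma norm_op_sqrt:
  assumes "psd \<rho>"
  shows "(norm (op_sqrt \<rho>))\<^sup>2 = Re (trace \<rho>)"
  by (simp add: norm_operator_squared adjoint_op_sqrt assms op_sqrt_mult_self)

text \<open>Roots of density operators are Frobenius unit vectors, so distance and overlap determine
  each other; this links \<open>bures_dist\<close> to \<open>fidelity\<close>.\<close>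

lemma norm_diff_sqrt_unitary:
  assumes "\<rho> \<in> density_ops" "\<sigma> \<in> density_ops" "unitary V"
  shows "(norm (op_sqrt \<rho> - op_sqrt \<sigma> ** V))\<^sup>2 = 2 - 2 * (op_sqrt \<rho> \<bullet> (op_sqrt \<sigma> ** V))"
proof -
  have "(norm (op_sqrt \<rho>))\<^sup>2 = 1" "(norm (op_sqrt \<sigma> ** V))\<^sup>2 = 1"
    using assms norm_op_sqrt[of \<rho>] norm_op_sqrt[of \<sigma>] by (simp_all add: norm_mult_unitary density_ops_def)
  then show ?thesis by (simp add: power2_norm_eq_inner algebra_simps inner_commute)
qed

lemma fidelity_le_1:
  assumes "\<rho> \<in> density_ops" "\<sigma> \<in> density_ops"
  shows "fidelity \<rho> \<sigma> \<le> 1"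
proof -
  obtain V where "unitary V" "op_sqrt \<rho> \<bullet> (op_sqrt \<sigma> ** V) = fidelity \<rho> \<sigma>"
    using fidelity_attained assms density_ops_psd by blast
  then show ?thesis
    using norm_diff_sqrt_unitary[OF assms, of V] zero_le_power2[of "norm (op_sqrt \<rho> - op_sqrt \<sigma> ** V)"]
    by simp
qed

lemma bures_dist_attained:
  assumes "\<rho> \<in> density_ops" "\<sigma> \<in> density_ops"
  obtains V where "unitary V" "norm (op_sqrt \<rho> - op_sqrt \<sigma> ** V) = bures_dist \<rho> \<sigma>"
proof -
  obtain V where V: "unitary V" "op_sqrt \<rho> \<bullet> (op_sqrt \<sigma> ** V) = fidelity \<rho> \<sigma>"
    using fidelity_attained assms density_ops_psd by blast
  then have "norm (op_sqrt \<rho> - op_sqrt \<sigma> ** V) = bures_dist \<rho> \<sigma>"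
    using norm_diff_sqrt_unitary[OF assms, of V] unfolding bures_dist_def
    by (metis norm_ge_zero real_sqrt_unique)
  with V that show ?thesis by blast
qed

lemma bures_dist_le:
  assumes "\<rho> \<in> density_ops" "\<sigma> \<in> density_ops" "unitary V"
  shows "bures_dist \<rho> \<sigma> \<le> norm (op_sqrt \<rho> - op_sqrt \<sigma> ** V)"
proof -
  have "op_sqrt \<rho> \<bullet> (op_sqrt \<sigma> ** V) \<le> fidelity \<rho> \<sigma>"
    using assms by (intro inner_le_fidelity sqrt_unitary_mult_adjoint density_ops_psd)
  then show ?thesis
    using norm_diff_sqrt_unitary[OF assms] unfolding bures_dist_def by (intro real_le_lsqrt) auto
qed

lemma bures_dist_sym:
  "\<rho> \<in> density_ops \<Longrightarrow> \<sigma> \<in> density_ops \<Longrightarrow> bures_dist \<rho> \<sigma> = bures_dist \<sigma> \<rho>"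
  by (simp add: bures_dist_def fidelity_sym density_ops_psd)

text \<open>The product \<open>W ** V\<close> of the two optimal unitaries may fail to be optimal
  for the outer pair, but it is admissible, and right multiplication by \<open>V\<close> preserves
  the length of the second leg.\<close>

lemma bures_dist_triangle:
  assumes "\<rho> \<in> density_ops" "\<sigma> \<in> density_ops" "\<tau> \<in> density_ops"
  shows "bures_dist \<rho> \<tau> \<le> bures_dist \<rho> \<sigma> + bures_dist \<sigma> \<tau>"
proof -
  obtain V where V: "unitary V" "norm (op_sqrt \<rho> - op_sqrt \<sigma> ** V) = bures_dist \<rho> \<sigma>"
    using bures_dist_attained assms by blast
  obtain W where W: "unitary W" "norm (op_sqrt \<sigma> - op_sqrt \<tau> ** W) = bures_dist \<sigma> \<tau>"
    using bures_dist_attained assms by blast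
  have "bures_dist \<rho> \<tau> \<le> norm (op_sqrt \<rho> - op_sqrt \<tau> ** (W ** V))"
    using assms V W by (intro bures_dist_le unitary_mult)
  also have "op_sqrt \<rho> - op_sqrt \<tau> ** (W ** V)
      = (op_sqrt \<rho> - op_sqrt \<sigma> ** V) + (op_sqrt \<sigma> - op_sqrt \<tau> ** W) ** V"
    by (simp add: matrix_mult_diff_left matrix_mul_assoc)
  also have "norm \<dots> \<le> norm (op_sqrt \<rho> - op_sqrt \<sigma> ** V) + norm ((op_sqrt \<sigma> - op_sqrt \<tau> ** W) ** V)"
    by (rule norm_triangle_ineq)
  finally show ?thesis using V W by (simp add: norm_mult_unitary)
qed

subsection \<open>Partial trace and the normalization map\<close>

lemma sum_prod_UNIV: "(\<Sum>p\<in>UNIV. f p) = (\<Sum>i\<in>UNIV. \<Sum>b\<in>UNIV. f (i, b))"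
  by (simp add: sum.cartesian_product flip: UNIV_Times_UNIV)

lemma tensor_id_mult_nth:
  "(tensor_op X (mat 1 :: 'b::finite operator) ** P) $ (i, b) $ q = (\<Sum>k\<in>UNIV. X $ i $ k * P $ (k, b) $ q)"
  by (simp add: matrix_matrix_mult_def tensor_op_def sum_prod_UNIV mat_def if_distrib[of "\<lambda>x. _ * x"]
      if_distrib[of "\<lambda>x. x * _"] cong: if_cong)

lemma mult_tensor_id_nth:
  "(P ** tensor_op X (mat 1 :: 'b::finite operator)) $ q $ (j, b) = (\<Sum>k\<in>UNIV. P $ q $ (k, b) * X $ k $ j)"
  by (simp add: matrix_matrix_mult_def tensor_op_def sum_prod_UNIV mat_def if_distrib[of "\<lambda>x. _ * x"]
      if_distrib[of "\<lambda>x. x * _"] cong: if_cong)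

lemma tensor_id_mult:
  "tensor_op X (mat 1 :: 'b::finite operator) ** tensor_op Y (mat 1) = tensor_op (X ** Y) (mat 1)"
proof -
  have "(tensor_op X (mat 1 :: 'b operator) ** tensor_op Y (mat 1)) $ (i, b) $ (j, c)
      = tensor_op (X ** Y) (mat 1) $ (i, b) $ (j, c)" for i b j c
    by (simp add: tensor_id_mult_nth) (simp add: tensor_op_def matrix_matrix_mult_def sum_distrib_right mult.assoc)
  then show ?thesis by (simp add: vec_eq_iff split_paired_all)
qed

lemma tensor_id_id [simp]: "tensor_op (mat 1) (mat 1) = mat 1"
  by (auto simp: vec_eq_iff tensor_op_def mat_def prod_eq_iff)

lemma adjoint_op_tensor: "adjoint_op (tensor_op X Y) = tensor_op (adjoint_op X) (adjoint_op Y)"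
  by (simp add: vec_eq_iff tensor_op_def)

text \<open>The operator is \<open>adjoint_op T ** T\<close> for \<open>T\<close> the tensor product
  of \<open>op_sqrt X\<close> with the identity.\<close>

lemma psd_tensor_id:
  assumes "psd X"
  shows "psd (tensor_op X (mat 1 :: 'b::finite operator))"
  using psd_adjoint_mult[of "tensor_op (op_sqrt X) (mat 1 :: 'b operator)"]
  by (simp add: adjoint_op_tensor adjoint_op_sqrt assms tensor_id_mult op_sqrt_mult_self)

lemma reduce_A_tensor_left: "reduce_A (tensor_op X (mat 1) ** P) = X ** reduce_A P"
  by (simp add: vec_eq_iff reduce_A_def tensor_id_mult_nth)
     (simp add: matrix_matrix_mult_def sum_distrib_left sum.swap[of _ UNIV "UNIV :: 'b set"])

lemma reduce_A_tensor_right: "reduce_A (P ** tensor_op X (mat 1)) = reduce_A P ** X"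
  by (simp add: vec_eq_iff reduce_A_def mult_tensor_id_nth)
     (simp add: matrix_matrix_mult_def sum_distrib_right sum.swap[of _ UNIV "UNIV :: 'b set"])

lemma reduce_A_scaleR: "reduce_A (c *\<^sub>R P) = c *\<^sub>R reduce_A P"
  by (simp add: vec_eq_iff reduce_A_def scaleR_sum_right)

lemma trace_reduce_A: "trace (reduce_A P) = trace P"
  by (simp add: trace_def reduce_A_def sum_prod_UNIV)

text \<open>Duality between partial trace and tensoring with the identity; through it the
  optimization sees only marginals.\<close>

lemma trace_tensor_id_mult: "trace (tensor_op X (mat 1) ** P) = trace (X ** reduce_A P)"
  using trace_reduce_A[of "tensor_op X (mat 1) ** P"] by (simp add: reduce_A_tensor_left)

section \<open>Positive definite operators and inverse square roots\<close>

lemma pos_def_imp_kernel_trivial: "pos_def X \<Longrightarrow> X *v x = 0 \<Longrightarrow> x = 0"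
  unfolding pos_def_def by fastforce

text \<open>By \<open>psd_kernel\<close>, a zero of the form is a kernel vector. The invertibility
  form gives the determinant criterion used for measurability.\<close>

lemma pos_def_iff: "pos_def X \<longleftrightarrow> psd X \<and> invertible X"
proof
  assume "pos_def X"
  then show "psd X \<and> invertible X"
    using pos_def_imp_kernel_trivial[of X]
    by (auto simp: pos_def_def invertible_left_inverse matrix_left_invertible_ker)
next
  assume X: "psd X \<and> invertible X"
  then have "x = 0" if "X *v x = 0" for x
    using that by (auto simp: invertible_left_inverse matrix_left_invertible_ker)
  with X psd_kernel show "pos_def X"
    unfolding pos_def_def by blast
qed

lemma invertible_op_sqrt:
  assumes "pos_def X"
  shows "invertible (op_sqrt X)"
  unfolding invertible_left_inverse matrix_left_invertible_ker
proof (intro allI impI)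
  fix x assume "op_sqrt X *v x = 0"
  then have "X *v x = 0"
    using assms op_sqrt_mult_self[of X]
    by (metis matrix_vector_mul_assoc matrix_vector_mult_0_right pos_def_def)
  then show "x = 0" using assms pos_def_imp_kernel_trivial by blast
qed

lemma matrix_inv_inverse:
  fixes S :: "'n::finite operator"
  assumes "invertible S"
  shows "matrix_inv S ** S = mat 1" "S ** matrix_inv S = mat 1"
  using assms unfolding invertible_def matrix_inv_def by (metis (mono_tags, lifting) someI_ex)+

lemma adjoint_op_matrix_inv:
  assumes "invertible S" "adjoint_op S = S"
  shows "adjoint_op (matrix_inv S) = matrix_inv S"
proof -
  have "adjoint_op (matrix_inv S) ** S = mat 1"
    using arg_cong[OF matrix_inv_inverse(2)[OF assms(1)], of adjoint_op] assms(2)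
    by (simp add: adjoint_op_mult)
  then have "adjoint_op (matrix_inv S) ** (S ** matrix_inv S) = matrix_inv S"
    by (simp add: matrix_mul_assoc)
  then show ?thesis by (simp add: matrix_inv_inverse assms)
qed

lemma inverse_sqrt_properties:
  fixes X :: "'n::finite operator"
  assumes "pos_def X"
  defines "S \<equiv> op_sqrt X" and "R \<equiv> matrix_inv (op_sqrt X)"
  shows "R ** S = mat 1" "S ** R = mat 1" "adjoint_op R = R" "R ** X = S" "R ** X ** R = mat 1" "psd S"
proof -
  have X: "psd X" using assms by (simp add: pos_def_def)
  show *: "R ** S = mat 1" "S ** R = mat 1"
    using matrix_inv_inverse[OF invertible_op_sqrt[OF assms(1)]] by (simp_all add: S_def R_def)
  show "adjoint_op R = R"
    unfolding R_def using X assms(1) by (intro adjoint_op_matrix_inv invertible_op_sqrt adjoint_op_sqrt)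
  have "R ** X = R ** S ** S"
    using op_sqrt_mult_self[OF X] by (simp add: S_def matrix_mul_assoc[symmetric])
  with * show "R ** X = S" "R ** X ** R = mat 1" by simp_all
  show "psd S" using X by (simp add: S_def psd_op_sqrt)
qed

section \<open>The normalization map as projection onto Choi states\<close>

lemma normalize_A_in_choi_states:
  fixes \<rho> :: "('a::finite \<times> 'b::finite) operator"
  assumes "psd \<rho>" "pos_def (reduce_A \<rho>)"
  shows "normalize_A \<rho> \<in> choi_states"
proof -
  let ?R = "matrix_inv (op_sqrt (reduce_A \<rho>))"
  let ?K = "tensor_op ?R (mat 1) :: ('a \<times> 'b) operator"
  have N: "normalize_A \<rho> = (1 / real CARD('a)) *\<^sub>R (adjoint_op ?K ** \<rho> ** ?K)"
    by (simp add: normalize_A_def Let_def adjoint_op_tensor inverse_sqrt_properties assms)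
  \<comment> \<open>Factors on the first system pass through the partial trace, so the marginal
    becomes that of \<open>\<rho>\<close> sandwiched between its own inverse roots.\<close>
  have red: "reduce_A (normalize_A \<rho>) = (1 / real CARD('a)) *\<^sub>R mat 1"
    by (simp add: normalize_A_def Let_def reduce_A_scaleR reduce_A_tensor_left reduce_A_tensor_right
        inverse_sqrt_properties assms)
  have "psd (normalize_A \<rho>)"
    unfolding N by (intro psd_scaleR psd_sandwich assms) simp
  moreover have "trace (normalize_A \<rho>) = 1"
    using trace_reduce_A[of "normalize_A \<rho>"] by (simp add: red trace_scaleR trace_I scaleR_conv_of_real[where 'a=complex])
  ultimately show ?thesis
    using red by (simp add: choi_states_def density_ops_def)
qed

text \<open>Both claims pass through the number \<open>c * t\<close>: every factor of a Choi state
  overlaps \<open>A\<close> by at most \<open>c * t\<close>, while \<open>normalize_A \<rho>\<close>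
  has a factor reaching it. Equal fidelities therefore force equality in the completed
  square.\<close>

lemma fidelity_choi_states:
  fixes \<rho> \<sigma> :: "('a::finite \<times> 'b::finite) operator"
  assumes \<rho>: "psd \<rho>" and pd: "pos_def (reduce_A \<rho>)" and \<sigma>: "\<sigma> \<in> choi_states"
  shows "fidelity \<rho> \<sigma> \<le> fidelity \<rho> (normalize_A \<rho>)"
    and "fidelity \<rho> \<sigma> = fidelity \<rho> (normalize_A \<rho>) \<Longrightarrow> \<sigma> = normalize_A \<rho>"
proof -
  define S where "S = op_sqrt (reduce_A \<rho>)"
  define R where "R = matrix_inv (op_sqrt (reduce_A \<rho>))"
  define L where "L = (tensor_op S (mat 1) :: ('a \<times> 'b) operator)"
  define K where "K = (tensor_op R (mat 1) :: ('a \<times> 'b) operator)"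
  define A where "A = op_sqrt \<rho>"
  define c where "c = 1 / sqrt (real CARD('a))"
  \<comment> \<open>The value \<open>c * t\<close> will be the maximal fidelity.\<close>
  define t where "t = Re (trace S)"
  have c: "c > 0" "c * c = 1 / real CARD('a)"
    by (simp_all add: c_def)
  have L: "psd L" and LK: "L ** K = mat 1" and KL: "K ** L = mat 1" and K: "adjoint_op K = K"
    using inverse_sqrt_properties[OF pd]
    by (simp_all add: L_def K_def S_def R_def psd_tensor_id tensor_id_mult adjoint_op_tensor)
  have A: "adjoint_op A = A" "A ** A = \<rho>"
    by (simp_all add: A_def adjoint_op_sqrt op_sqrt_mult_self \<rho>)
  have N: "normalize_A \<rho> = (c * c) *\<^sub>R (K ** \<rho> ** K)"
    by (simp add: normalize_A_def Let_def K_def R_def c)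
  have trK: "Re (trace (K ** \<rho>)) = t"
    using inverse_sqrt_properties[OF pd] by (simp add: K_def trace_tensor_id_mult t_def R_def S_def)
  have bound: "A \<bullet> B \<le> c * t" and eq: "A \<bullet> B = c * t \<Longrightarrow> \<sigma> = normalize_A \<rho>"
    if B: "B ** adjoint_op B = \<sigma>" for B
  proof -
    \<comment> \<open>The deviation of \<open>B\<close> from \<open>c *\<^sub>R (K ** A)\<close>, a
      factor of \<open>normalize_A \<rho>\<close>.\<close>
    define D where "D = B - c *\<^sub>R (K ** A)"
    have Dadj: "adjoint_op D = adjoint_op B - c *\<^sub>R (A ** K)"
      by (simp add: D_def adjoint_op_diff adjoint_op_scaleR adjoint_op_mult K A)
    have AKL: "A ** K ** L = A"
      using KL by (simp flip: matrix_mul_assoc)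
    have "adjoint_op D ** L ** D = (adjoint_op B ** L - c *\<^sub>R A) ** (B - c *\<^sub>R (K ** A))"
      unfolding Dadj by (simp add: D_def matrix_mult_diff_left scaleR_matrix_mult AKL)
    also have "\<dots> = adjoint_op B ** L ** B - c *\<^sub>R (adjoint_op B ** A) - c *\<^sub>R (A ** B)
        + (c * c) *\<^sub>R (A ** K ** A)"
    proof -
      have "adjoint_op B ** L ** (K ** A) = adjoint_op B ** (L ** K) ** A"
        by (simp add: matrix_mul_assoc)
      then show ?thesis
        by (simp add: matrix_mult_diff_left matrix_mult_diff_right scaleR_matrix_mult matrix_mult_scaleR LK
            matrix_mul_assoc algebra_simps)
    qed
    finally have "Re (trace (adjoint_op D ** L ** D)) = Re (trace (adjoint_op B ** L ** B))
        - c * (B \<bullet> A) - c * (A \<bullet> B) + c * c * Re (trace (A ** K ** A))"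
      by (simp add: trace_add trace_sub trace_scaleR inner_operator A)
    also have "trace (adjoint_op B ** L ** B) = trace (L ** \<sigma>)"
      by (metis B matrix_mul_assoc trace_mul_sym)
    \<comment> \<open>Here the prescribed marginal of \<open>\<sigma>\<close> enters and removes the
      dependence on the competitor.\<close>
    also have "Re (trace (L ** \<sigma>)) = c * c * t"
      using \<sigma> by (simp add: L_def trace_tensor_id_mult choi_states_def matrix_mult_scaleR trace_scaleR t_def c)
    also have "trace (A ** K ** A) = trace (K ** \<rho>)"
      by (metis A(2) matrix_mul_assoc trace_mul_sym)
    finally have trD: "Re (trace (adjoint_op D ** L ** D)) = 2 * c * (c * t - A \<bullet> B)"
      by (simp add: trK inner_commute algebra_simps)
    have "Re (trace (adjoint_op D ** L ** D)) \<ge> 0"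
      using trace_psd_nonneg[OF psd_sandwich[OF L]] by (simp add: complex_nonneg_Reals_iff)
    with trD c show "A \<bullet> B \<le> c * t"
      by (simp add: zero_le_mult_iff)
    show "\<sigma> = normalize_A \<rho>" if "A \<bullet> B = c * t"
    proof -
      have "L ** D = 0"
        using trace_sandwich_eq_0[OF L, of D] trD that by simp
      have "D = K ** L ** D" by (simp add: KL)
      also have "\<dots> = 0"
        using \<open>L ** D = 0\<close> by (simp add: matrix_mult_0_right flip: matrix_mul_assoc)
      finally have "B = c *\<^sub>R (K ** A)" by (simp add: D_def)
      then have "\<sigma> = (c * c) *\<^sub>R (K ** A ** (A ** K))"
        using B by (simp add: adjoint_op_scaleR adjoint_op_mult K A scaleR_matrix_mult matrix_mult_scaleR)
      also have "K ** A ** (A ** K) = K ** (A ** A) ** K"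
        by (simp add: matrix_mul_assoc)
      finally show ?thesis by (simp add: N A)
    qed
  qed
  have psdN: "psd (normalize_A \<rho>)" "psd \<sigma>"
    using normalize_A_in_choi_states[OF \<rho> pd] \<sigma> by (simp_all add: choi_states_def density_ops_def)
  \<comment> \<open>The explicit factor \<open>c *\<^sub>R (K ** A)\<close> is a candidate in
    Uhlmann's bound, so the fidelity with \<open>normalize_A \<rho>\<close> is at least
    \<open>c * t\<close>.\<close>
  have "K ** A ** (A ** K) = K ** (A ** A) ** K"
    by (simp add: matrix_mul_assoc)
  then have "(c *\<^sub>R (K ** A)) ** adjoint_op (c *\<^sub>R (K ** A)) = normalize_A \<rho>"
    by (simp add: adjoint_op_scaleR adjoint_op_mult K A N scaleR_matrix_mult matrix_mult_scaleR)
  then have "A \<bullet> (c *\<^sub>R (K ** A)) \<le> fidelity \<rho> (normalize_A \<rho>)"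
    unfolding A_def by (intro inner_le_fidelity \<rho> psdN)
  moreover have "A \<bullet> (c *\<^sub>R (K ** A)) = c * t"
  proof -
    have "trace (A ** (K ** A)) = trace (K ** \<rho>)"
      by (metis A(2) matrix_mul_assoc trace_mul_sym)
    then show ?thesis using trK by (simp add: inner_operator A matrix_mult_scaleR trace_scaleR)
  qed
  ultimately have ge: "c * t \<le> fidelity \<rho> (normalize_A \<rho>)" by (simp only:)
  \<comment> \<open>An optimal factor of \<open>\<sigma>\<close> turns the bound on overlaps into a
    bound on the fidelity.\<close>
  obtain V where V: "unitary V" "A \<bullet> (op_sqrt \<sigma> ** V) = fidelity \<rho> \<sigma>"
    using fidelity_attained \<rho> psdN unfolding A_def by blast
  note B = sqrt_unitary_mult_adjoint[OF psdN(2) V(1)]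
  show "fidelity \<rho> \<sigma> \<le> fidelity \<rho> (normalize_A \<rho>)"
    using bound[OF B] ge V by simp
  show "\<sigma> = normalize_A \<rho>" if "fidelity \<rho> \<sigma> = fidelity \<rho> (normalize_A \<rho>)"
    using bound[OF B] eq[OF B] ge V that by simp
qed

lemma normalize_A_unique_maximizer:
  assumes "psd \<rho>" "pos_def (reduce_A \<rho>)"
  shows "is_arg_max (fidelity \<rho>) (\<lambda>\<tau>. \<tau> \<in> choi_states) \<sigma> \<longleftrightarrow> \<sigma> = normalize_A \<rho>"
proof
  assume \<sigma>: "is_arg_max (fidelity \<rho>) (\<lambda>\<tau>. \<tau> \<in> choi_states) \<sigma>"
  then have "\<sigma> \<in> choi_states" "\<not> fidelity \<rho> \<sigma> < fidelity \<rho> (normalize_A \<rho>)"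
    using normalize_A_in_choi_states[OF assms] by (auto simp: is_arg_max_def)
  then show "\<sigma> = normalize_A \<rho>"
    using fidelity_choi_states[OF assms] by (meson antisym_conv2)
next
  assume "\<sigma> = normalize_A \<rho>"
  then show "is_arg_max (fidelity \<rho>) (\<lambda>\<tau>. \<tau> \<in> choi_states) \<sigma>"
    using fidelity_choi_states(1)[OF assms] normalize_A_in_choi_states[OF assms]
    by (auto simp: is_arg_max_def not_less)
qed

text \<open>Optimality depends only on the strict order of the values, so the result for fidelity
  transfers to both distances.\<close>

lemma is_arg_min_iff_is_arg_max:
  assumes "\<And>x y. P x \<Longrightarrow> P y \<Longrightarrow> f x < f y \<longleftrightarrow> g y < g x"
  shows "is_arg_min f P x \<longleftrightarrow> is_arg_max g P x"
  using assms unfolding is_arg_min_def is_arg_max_def by blast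

lemma choi_states_density: "\<sigma> \<in> choi_states \<Longrightarrow> \<sigma> \<in> density_ops"
  by (simp add: choi_states_def)

text \<open>The real \<open>sqrt\<close> extends oddly to negative arguments and is strictly
  increasing everywhere, so arbitrary operators can be compared.\<close>

lemma bures_dist_less_iff: "bures_dist \<rho> \<sigma> < bures_dist \<rho> \<tau> \<longleftrightarrow> fidelity \<rho> \<tau> < fidelity \<rho> \<sigma>"
  by (simp add: bures_dist_def)

text \<open>Besides the root, squaring has to preserve strict order; it does because fidelities are
  nonnegative.\<close>

lemma purified_dist_less_iff: "purified_dist \<rho> \<sigma> < purified_dist \<rho> \<tau> \<longleftrightarrow> fidelity \<rho> \<tau> < fidelity \<rho> \<sigma>"
  using fidelity_nonneg[of \<rho> \<sigma>] fidelity_nonneg[of \<rho> \<tau>]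
  by (simp add: purified_dist_def power_strict_mono power_less_imp_less_base flip: not_le)

section \<open>Stability of the projection\<close>

lemma proj_choi_in_choi_states:
  "\<rho> \<in> density_ops \<Longrightarrow> pos_def (reduce_A \<rho>) \<Longrightarrow> proj_choi \<rho> \<in> choi_states"
  by (simp add: proj_choi_def normalize_A_in_choi_states density_ops_psd)

lemma bures_dist_proj_choi:
  assumes \<rho>: "\<rho> \<in> choi_states" and \<rho>': "\<rho>' \<in> density_ops" "pos_def (reduce_A \<rho>')"
  shows "bures_dist \<rho> (proj_choi \<rho>') \<le> 2 * bures_dist \<rho> \<rho>'"
proof -
  have d: "\<rho> \<in> density_ops" "proj_choi \<rho>' \<in> density_ops"
    using \<rho> proj_choi_in_choi_states[OF \<rho>'] by (simp_all add: choi_states_density)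
  have "bures_dist \<rho> (proj_choi \<rho>') \<le> bures_dist \<rho> \<rho>' + bures_dist \<rho>' (proj_choi \<rho>')"
    by (intro bures_dist_triangle d \<rho>')
  \<comment> \<open>The Choi state \<open>\<rho>\<close> is itself a competitor for
    \<open>\<rho>'\<close>, so the projection is at least as close.\<close>
  also have "bures_dist \<rho>' (proj_choi \<rho>') \<le> bures_dist \<rho>' \<rho>"
    using fidelity_choi_states(1)[OF density_ops_psd \<rho>'(2) \<rho>] \<rho>' by (simp add: bures_dist_def proj_choi_def)
  also have "bures_dist \<rho>' \<rho> = bures_dist \<rho> \<rho>'"
    by (intro bures_dist_sym d \<rho>')
  finally show ?thesis by simp
qed

text \<open>Squaring the Bures bound turns 2 into 4; \<open>fidelity_le_1\<close> makes the
  radicands nonnegative, so that squaring undoes the roots.\<close>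

lemma fidelity_proj_choi:
  assumes \<rho>: "\<rho> \<in> choi_states" and \<rho>': "\<rho>' \<in> density_ops" "pos_def (reduce_A \<rho>')"
  shows "1 - fidelity \<rho> (proj_choi \<rho>') \<le> 4 * (1 - fidelity \<rho> \<rho>')"
proof -
  have d: "\<rho> \<in> density_ops" "proj_choi \<rho>' \<in> density_ops"
    using \<rho> proj_choi_in_choi_states[OF \<rho>'] by (simp_all add: choi_states_density)
  have "(bures_dist \<rho> (proj_choi \<rho>'))\<^sup>2 \<le> (2 * bures_dist \<rho> \<rho>')\<^sup>2"
    using bures_dist_proj_choi[OF assms] fidelity_le_1[OF d] by (intro power_mono) (simp_all add: bures_dist_def)
  then show ?thesis
    using fidelity_le_1[OF d] fidelity_le_1[OF d(1) \<rho>'(1)] by (simp add: bures_dist_def power_mult_distrib)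
qed

subsection \<open>The Choi isomorphism\<close>

definition matrix_unit :: "'n::finite \<Rightarrow> 'n \<Rightarrow> 'n operator" where
  "matrix_unit i j = (\<chi> k l. if k = i \<and> l = j then 1 else 0)"

lemma matrix_unit_vec: "cinner x (matrix_unit i j *v y) = cnj (x $ i) * y $ j"
proof -
  have "matrix_unit i j *v y = (\<chi> k. if k = i then y $ j else 0)"
    by (auto simp: vec_eq_iff matrix_unit_def matrix_vector_mult_def if_distrib[of "\<lambda>x. x * _"] cong: if_cong)
  then show ?thesis
    by (simp add: cinner_def if_distrib[of "\<lambda>x. _ * x"] cong: if_cong)
qed

lemma trace_matrix_unit: "trace (matrix_unit i j) = (if i = j then 1 else 0)"
  by (cases "i = j") (simp_all add: trace_def matrix_unit_def sum.neutral)

lemma operator_expansion: "X = (\<Sum>i\<in>UNIV. \<Sum>j\<in>UNIV. map_matrix ((*) (X $ i $ j)) (matrix_unit i j))"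
proof -
  have "(\<Sum>i\<in>UNIV. \<Sum>j\<in>UNIV. map_matrix ((*) (X $ i $ j)) (matrix_unit i j)) $ k $ l
      = (\<Sum>i\<in>UNIV. \<Sum>j\<in>UNIV. if k = i then if l = j then X $ i $ j else 0 else 0)" for k l
    by (auto simp: map_matrix_def matrix_unit_def intro!: sum.cong)
  also have "\<dots> k l = (\<Sum>i\<in>UNIV. if k = i then \<Sum>j\<in>UNIV. if l = j then X $ i $ j else 0 else 0)" for k l
    by (intro sum.cong) auto
  finally show ?thesis by (simp add: vec_eq_iff)
qed

lemma complex_scale_0: "map_matrix ((*) 0) X = (0 :: 'n::finite operator)"
  by (simp add: vec_eq_iff map_matrix_def)

lemma complex_linear_map_sum:
  assumes "complex_linear_map \<Phi>" "finite S"
  shows "\<Phi> (\<Sum>i\<in>S. f i) = (\<Sum>i\<in>S. \<Phi> (f i))"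
  using assms(2)
proof induction
  case empty
  have "\<Phi> (map_matrix ((*) 0) 0) = map_matrix ((*) 0) (\<Phi> 0)"
    using assms(1) unfolding complex_linear_map_def by blast
  then show ?case by (simp add: complex_scale_0)
next
  case (insert x F)
  then show ?case using assms(1) by (simp add: complex_linear_map_def)
qed

lemma complex_linear_map_expansion:
  assumes "complex_linear_map \<Phi>"
  shows "\<Phi> X $ b $ c = (\<Sum>i\<in>UNIV. \<Sum>j\<in>UNIV. X $ i $ j * \<Phi> (matrix_unit i j) $ b $ c)"
proof -
  have "\<Phi> X = (\<Sum>i\<in>UNIV. \<Sum>j\<in>UNIV. map_matrix ((*) (X $ i $ j)) (\<Phi> (matrix_unit i j)))"
    using assms by (subst operator_expansion) (simp add: complex_linear_map_sum complex_linear_map_def)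
  then show ?thesis by (simp add: map_matrix_def)
qed

lemma choi_nth:
  fixes \<Phi> :: "'a::finite operator \<Rightarrow> 'b::finite operator"
  assumes "complex_linear_map \<Phi>"
  shows "choi \<Phi> $ (i, b) $ (j, c) = \<Phi> (matrix_unit i j) $ b $ c / of_nat CARD('a)"
proof -
  \<comment> \<open>The \<open>(i, j)\<close> block of the maximally entangled projector is a matrix
    unit divided by the dimension.\<close>
  have "(\<chi> k l. ketbra (max_entangled :: complex ^ ('a \<times> 'a)) $ (i, k) $ (j, l))
      = map_matrix ((*) (1 / of_nat CARD('a))) (matrix_unit i j)"
    by (auto simp: vec_eq_iff ketbra_def max_entangled_def map_matrix_def matrix_unit_def
        simp flip: of_real_mult)
  then show ?thesis
    using assms by (simp add: choi_def id_tensor_def complex_linear_map_def)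
qed

text \<open>Inversion formula for the Choi map: it gives injectivity and dictates the definition of
  \<open>choi_channel\<close>.\<close>

lemma choi_apply:
  fixes \<Phi> :: "'a::finite operator \<Rightarrow> 'b::finite operator"
  assumes "complex_linear_map \<Phi>"
  shows "\<Phi> X $ b $ c = of_nat CARD('a) * (\<Sum>i\<in>UNIV. \<Sum>j\<in>UNIV. X $ i $ j * choi \<Phi> $ (i, b) $ (j, c))"
  by (simp add: complex_linear_map_expansion[OF assms, of X] choi_nth[OF assms] flip: sum_divide_distrib)

lemma choi_inj:
  assumes "quantum_channel \<Phi>" "quantum_channel \<Psi>" "choi \<Phi> = choi \<Psi>"
  shows "\<Phi> = \<Psi>"
  using assms choi_apply[of \<Phi>] choi_apply[of \<Psi>] by (simp add: quantum_channel_def fun_eq_iff vec_eq_iff)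

text \<open>The double sum factors as a squared modulus. For an enumeration \<open>f\<close> of the
  index type these are the blocks of the unnormalized maximally entangled projector.\<close>

lemma block_psd_matrix_units: "block_psd n (\<lambda>i j. matrix_unit (f i) (f j))"
  unfolding block_psd_def
proof
  fix v :: "nat \<Rightarrow> complex ^ 'a"
  define s where "s = (\<Sum>i<n. v i $ f i)"
  have "(\<Sum>i<n. \<Sum>j<n. cinner (v i) (matrix_unit (f i) (f j) *v v j)) = cnj s * s"
    by (simp add: matrix_unit_vec sum_product s_def)
  also have "\<dots> = of_real ((cmod s)\<^sup>2)"
    by (simp only: complex_norm_square mult.commute)
  finally show "(\<Sum>i<n. \<Sum>j<n. cinner (v i) (matrix_unit (f i) (f j) *v v j)) \<in> \<real>\<^sub>\<ge>\<^sub>0"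
    by (simp add: complex_nonneg_Reals_iff)
qed

text \<open>Complete positivity is phrased with references indexed by naturals, so \<open>f\<close>
  enumerates \<open>'a\<close> to transport the blocks of the Choi operator to that form.\<close>

lemma psd_choi:
  fixes \<Phi> :: "'a::finite operator \<Rightarrow> 'b::finite operator"
  assumes lin: "complex_linear_map \<Phi>" and "completely_positive \<Phi>"
  shows "psd (choi \<Phi>)"
  unfolding psd_def
proof
  fix x :: "complex ^ ('a \<times> 'b)"
  obtain f :: "nat \<Rightarrow> 'a" where f: "bij_betw f {..<CARD('a)} UNIV"
    using ex_bij_betw_nat_finite[of "UNIV :: 'a set"] by (auto simp: atLeast0LessThan)
  define v where "v = (\<lambda>i. \<chi> b. x $ (i, b))"
  define d where "d = (of_nat CARD('a) :: complex)"
  have "cinner x (choi \<Phi> *v x)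
      = (\<Sum>i\<in>UNIV. \<Sum>b\<in>UNIV. \<Sum>j\<in>UNIV. \<Sum>c\<in>UNIV. cnj (x $ (i, b)) * \<Phi> (matrix_unit i j) $ b $ c * x $ (j, c) / d)"
    by (simp add: cinner_def matrix_vector_mult_def sum_prod_UNIV choi_nth[OF lin] sum_distrib_left mult.assoc d_def)
  also have "\<dots> = (\<Sum>i\<in>UNIV. \<Sum>j\<in>UNIV. \<Sum>b\<in>UNIV. \<Sum>c\<in>UNIV. cnj (x $ (i, b)) * \<Phi> (matrix_unit i j) $ b $ c * x $ (j, c) / d)"
    by (intro sum.cong refl sum.swap)
  also have "\<dots> = (\<Sum>i\<in>UNIV. \<Sum>j\<in>UNIV. cinner (v i) (\<Phi> (matrix_unit i j) *v v j)) / d"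
    by (simp add: cinner_def matrix_vector_mult_def v_def sum_distrib_left sum_divide_distrib mult.assoc)
  also have "(\<Sum>i\<in>UNIV. \<Sum>j\<in>UNIV. cinner (v i) (\<Phi> (matrix_unit i j) *v v j))
      = (\<Sum>i<CARD('a). \<Sum>j<CARD('a). cinner (v (f i)) (\<Phi> (matrix_unit (f i) (f j)) *v v (f j)))"
    by (simp add: sum.reindex_bij_betw[OF f, symmetric])
  finally have eq: "cinner x (choi \<Phi> *v x) = \<dots> / d" .
  have "block_psd CARD('a) (\<lambda>i j. \<Phi> (matrix_unit (f i) (f j)))"
    using assms(2) block_psd_matrix_units unfolding completely_positive_def by blast
  then have "(\<Sum>i<CARD('a). \<Sum>j<CARD('a). cinner (v (f i)) (\<Phi> (matrix_unit (f i) (f j)) *v v (f j))) \<in> \<real>\<^sub>\<ge>\<^sub>0"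
    unfolding block_psd_def by (elim allE[of _ "\<lambda>i. v (f i)"])
  then show "cinner x (choi \<Phi> *v x) \<in> \<real>\<^sub>\<ge>\<^sub>0"
    unfolding eq d_def by (intro nonneg_Reals_divide_I) (simp_all add: complex_nonneg_Reals_iff)
qed

lemma choi_in_choi_states:
  fixes \<Phi> :: "'a::finite operator \<Rightarrow> 'b::finite operator"
  assumes "quantum_channel \<Phi>"
  shows "choi \<Phi> \<in> choi_states"
proof -
  have lin: "complex_linear_map \<Phi>" and "completely_positive \<Phi>" and tr: "trace (\<Phi> X) = trace X" for X
    using assms by (auto simp: quantum_channel_def)
  then have psd: "psd (choi \<Phi>)" by (intro psd_choi)
  \<comment> \<open>Trace preservation on matrix units alone fixes the marginal.\<close>
  have "reduce_A (choi \<Phi>) $ i $ j = trace (\<Phi> (matrix_unit i j)) / of_nat CARD('a)" for i j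
    by (simp add: reduce_A_def choi_nth[OF lin] trace_def sum_divide_distrib)
  then have red: "reduce_A (choi \<Phi>) = (1 / real CARD('a)) *\<^sub>R mat 1"
    by (simp add: vec_eq_iff tr trace_matrix_unit mat_def scaleR_conv_of_real[where 'a=complex])
  then have "trace (choi \<Phi>) = 1"
    using trace_reduce_A[of "choi \<Phi>"] by (simp add: trace_scaleR trace_I scaleR_conv_of_real[where 'a=complex])
  with psd red show ?thesis by (simp add: choi_states_def density_ops_def)
qed

text \<open>The right-hand side of \<open>choi_apply\<close> with an arbitrary \<open>J\<close>, as
  the candidate inverse of the Choi map.\<close>

definition choi_channel :: "('a::finite \<times> 'b::finite) operator \<Rightarrow> 'a operator \<Rightarrow> 'b operator" where
  "choi_channel J X = (\<chi> b c. of_nat CARD('a) * (\<Sum>k\<in>UNIV. \<Sum>l\<in>UNIV. X $ k $ l * J $ (k, b) $ (l, c)))"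

lemma complex_linear_map_choi_channel: "complex_linear_map (choi_channel J)"
  unfolding complex_linear_map_def
proof (intro conjI allI)
  show "choi_channel J (X + Y) = choi_channel J X + choi_channel J Y" for X Y
    by (simp add: choi_channel_def vec_eq_iff distrib_right sum.distrib distrib_left)
  show "choi_channel J (map_matrix ((*) c) X) = map_matrix ((*) c) (choi_channel J X)" for c X
    by (simp add: choi_channel_def vec_eq_iff map_matrix_def sum_distrib_left mult_ac)
qed

lemma sum_swap_pairs:
  "(\<Sum>b\<in>UNIV. \<Sum>c\<in>UNIV. \<Sum>m\<in>UNIV. f b c m) = (\<Sum>m\<in>UNIV. \<Sum>b\<in>UNIV. \<Sum>c\<in>UNIV. f b c m)"
  for f :: "'b::finite \<Rightarrow> 'c::finite \<Rightarrow> 'm::finite \<Rightarrow> complex"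
  by (simp add: sum.swap[of _ "UNIV :: 'm set"])

text \<open>The columns of the square root of \<open>J\<close> are Kraus operators, indexed by \<open>m\<close>.\<close>

lemma cinner_choi_channel:
  fixes J :: "('a::finite \<times> 'b::finite) operator"
  assumes "psd J"
  defines "w \<equiv> \<lambda>m v. \<chi> k. \<Sum>b\<in>UNIV. cnj (op_sqrt J $ (k, b) $ m) * v $ b"
  shows "cinner x (choi_channel J X *v y) = of_nat CARD('a) * (\<Sum>m\<in>UNIV. cinner (w m x) (X *v w m y))"
proof -
  let ?S = "op_sqrt J" and ?d = "of_nat CARD('a) :: complex"
  have J: "J $ p $ q = (\<Sum>m\<in>UNIV. ?S $ p $ m * cnj (?S $ q $ m))" for p q
  proof -
    have "J = ?S ** adjoint_op ?S"
      by (simp add: adjoint_op_sqrt op_sqrt_mult_self assms(1))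
    then have "J $ p $ q = (?S ** adjoint_op ?S) $ p $ q"
      by (rule arg_cong)
    then show ?thesis by (simp add: matrix_matrix_mult_def)
  qed
  have kraus: "(\<Sum>b\<in>UNIV. \<Sum>c\<in>UNIV. cnj (x $ b) * J $ (k, b) $ (l, c) * y $ c)
      = (\<Sum>m\<in>UNIV. cnj (w m x $ k) * w m y $ l)" for k l
  proof -
    have "(\<Sum>b\<in>UNIV. \<Sum>c\<in>UNIV. cnj (x $ b) * J $ (k, b) $ (l, c) * y $ c)
        = (\<Sum>b\<in>UNIV. \<Sum>c\<in>UNIV. \<Sum>m\<in>UNIV. (?S $ (k, b) $ m * cnj (x $ b)) * (cnj (?S $ (l, c) $ m) * y $ c))"
      by (simp add: J sum_distrib_left sum_distrib_right mult_ac)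
    also have "\<dots> = (\<Sum>m\<in>UNIV. \<Sum>b\<in>UNIV. \<Sum>c\<in>UNIV. (?S $ (k, b) $ m * cnj (x $ b)) * (cnj (?S $ (l, c) $ m) * y $ c))"
      by (rule sum_swap_pairs)
    finally show ?thesis by (simp add: w_def sum_product)
  qed
  have "cinner x (choi_channel J X *v y)
      = (\<Sum>b\<in>UNIV. \<Sum>c\<in>UNIV. \<Sum>p\<in>UNIV. ?d * (X $ fst p $ snd p * (cnj (x $ b) * J $ (fst p, b) $ (snd p, c) * y $ c)))"
    by (simp add: cinner_def matrix_vector_mult_def choi_channel_def sum_prod_UNIV sum_distrib_left
        sum_distrib_right mult_ac)
  also have "\<dots> = (\<Sum>p\<in>UNIV. \<Sum>b\<in>UNIV. \<Sum>c\<in>UNIV. ?d * (X $ fst p $ snd p * (cnj (x $ b) * J $ (fst p, b) $ (snd p, c) * y $ c)))"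
    by (rule sum_swap_pairs)
  also have "\<dots> = ?d * (\<Sum>k\<in>UNIV. \<Sum>l\<in>UNIV. X $ k $ l *
      (\<Sum>b\<in>UNIV. \<Sum>c\<in>UNIV. cnj (x $ b) * J $ (k, b) $ (l, c) * y $ c))"
    by (simp add: sum_prod_UNIV sum_distrib_left)
  also have "\<dots> = ?d * (\<Sum>k\<in>UNIV. \<Sum>l\<in>UNIV. \<Sum>m\<in>UNIV. cnj (w m x $ k) * (X $ k $ l * w m y $ l))"
    by (simp only: kraus) (simp add: sum_distrib_left mult_ac)
  also have "\<dots> = ?d * (\<Sum>m\<in>UNIV. \<Sum>k\<in>UNIV. \<Sum>l\<in>UNIV. cnj (w m x $ k) * (X $ k $ l * w m y $ l))"
    by (subst sum_swap_pairs) (rule refl)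
  also have "\<dots> = ?d * (\<Sum>m\<in>UNIV. cinner (w m x) (X *v w m y))"
    by (simp add: cinner_def matrix_vector_mult_def sum_distrib_left)
  finally show ?thesis .
qed

text \<open>Each Kraus index \<open>m\<close> contributes the block form of \<open>X\<close> at the
  vectors \<open>w m\<close>, the images of \<open>v\<close> under the adjoint Kraus operator, and
  this is nonnegative by hypothesis.\<close>

lemma completely_positive_choi_channel:
  fixes J :: "('a::finite \<times> 'b::finite) operator"
  assumes "psd J"
  shows "completely_positive (choi_channel J)"
  unfolding completely_positive_def
proof (intro allI impI)
  fix n and X :: "nat \<Rightarrow> nat \<Rightarrow> 'a operator"
  assume X: "block_psd n X"
  show "block_psd n (\<lambda>i j. choi_channel J (X i j))"
    unfolding block_psd_def
  proof
    fix v :: "nat \<Rightarrow> complex ^ 'b"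
    define w where "w = (\<lambda>m i. \<chi> k. \<Sum>b\<in>UNIV. cnj (op_sqrt J $ (k, b) $ m) * v i $ b)"
    have "(\<Sum>i<n. \<Sum>j<n. cinner (v i) (choi_channel J (X i j) *v v j))
        = of_nat CARD('a) * (\<Sum>i<n. \<Sum>j<n. \<Sum>m\<in>UNIV. cinner (w m i) (X i j *v w m j))"
      by (simp add: cinner_choi_channel[OF assms] w_def sum_distrib_left)
    also have "(\<Sum>i<n. \<Sum>j<n. \<Sum>m\<in>UNIV. cinner (w m i) (X i j *v w m j))
        = (\<Sum>m\<in>UNIV. \<Sum>i<n. \<Sum>j<n. cinner (w m i) (X i j *v w m j))"
      by (simp add: sum.swap[of _ UNIV])
    also have "of_nat CARD('a) * \<dots> \<in> \<real>\<^sub>\<ge>\<^sub>0"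
    proof -
      have "(\<Sum>i<n. \<Sum>j<n. cinner (w m i) (X i j *v w m j)) \<in> \<real>\<^sub>\<ge>\<^sub>0" for m
        using X unfolding block_psd_def by (elim allE[of _ "w m"])
      then show ?thesis
        by (simp add: complex_nonneg_Reals_iff sum_nonneg)
    qed
    finally show "(\<Sum>i<n. \<Sum>j<n. cinner (v i) (choi_channel J (X i j) *v v j)) \<in> \<real>\<^sub>\<ge>\<^sub>0" .
  qed
qed

lemma choi_choi_channel: "choi (choi_channel J) = J"
proof -
  have "choi_channel J (matrix_unit i j) $ b $ c = of_nat CARD('a) * J $ (i, b) $ (j, c)"
    for i j b c and J :: "('a::finite \<times> 'b::finite) operator"
  proof -
    have "(\<Sum>k\<in>UNIV. \<Sum>l\<in>UNIV. matrix_unit i j $ k $ l * J $ (k, b) $ (l, c))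
        = (\<Sum>k\<in>UNIV. if k = i then \<Sum>l\<in>UNIV. if l = j then J $ (k, b) $ (l, c) else 0 else 0)"
      by (intro sum.cong refl) (auto simp: matrix_unit_def if_distrib[of "\<lambda>x. x * _"] cong: if_cong)
    then show ?thesis by (simp add: choi_channel_def)
  qed
  then show ?thesis
    by (simp add: vec_eq_iff split_paired_all choi_nth complex_linear_map_choi_channel)
qed

lemma quantum_channel_choi_channel:
  fixes J :: "('a::finite \<times> 'b::finite) operator"
  assumes "J \<in> choi_states"
  shows "quantum_channel (choi_channel J)"
  unfolding quantum_channel_def
proof (intro conjI allI complex_linear_map_choi_channel completely_positive_choi_channel)
  show "psd J" using assms by (simp add: choi_states_def density_ops_def)
  fix X :: "'a operator"
  \<comment> \<open>The trace of the output pairs \<open>X\<close> with these marginal entries, so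
    the prescribed marginal gives trace preservation.\<close>
  have red: "(\<Sum>b\<in>UNIV. J $ (k, b) $ (l, b)) = (if k = l then 1 / of_nat CARD('a) else 0)" for k l
  proof -
    have "(\<Sum>b\<in>UNIV. J $ (k, b) $ (l, b)) = reduce_A J $ k $ l"
      by (simp add: reduce_A_def)
    then show ?thesis
      using assms by (simp add: choi_states_def mat_def scaleR_conv_of_real[where 'a=complex])
  qed
  have "trace (choi_channel J X) = of_nat CARD('a) * (\<Sum>b\<in>UNIV. \<Sum>p\<in>UNIV. X $ fst p $ snd p * J $ (fst p, b) $ (snd p, b))"
    by (simp add: trace_def choi_channel_def sum_prod_UNIV sum_distrib_left)
  also have "\<dots> = of_nat CARD('a) * (\<Sum>p\<in>UNIV. \<Sum>b\<in>UNIV. X $ fst p $ snd p * J $ (fst p, b) $ (snd p, b))"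
    by (subst sum.swap) (rule refl)
  also have "\<dots> = of_nat CARD('a) * (\<Sum>k\<in>UNIV. \<Sum>l\<in>UNIV. X $ k $ l * (if k = l then 1 / of_nat CARD('a) else 0))"
    by (simp add: sum_prod_UNIV red flip: sum_distrib_left)
  also have "\<dots> = trace X"
    by (simp add: trace_def if_distrib[of "\<lambda>x. _ * x"] cong: if_cong flip: sum_divide_distrib)
  finally show "trace (choi_channel J X) = trace X" .
qed

lemma choi_channel_unique:
  assumes "\<sigma> \<in> choi_states"
  shows "\<exists>!\<Psi>. quantum_channel \<Psi> \<and> choi \<Psi> = \<sigma>"
  using quantum_channel_choi_channel[OF assms] choi_choi_channel[of \<sigma>] choi_inj by blast

lemma choi_states_iff: "\<sigma> \<in> choi_states \<longleftrightarrow> (\<exists>\<Psi>. quantum_channel \<Psi> \<and> choi \<Psi> = \<sigma>)"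
  using choi_channel_unique choi_in_choi_states by blast

subsection \<open>Measurability\<close>

lemma closed_psd: "closed {X. psd X}"
  unfolding psd_def complex_nonneg_Reals_iff
  by (intro closed_Collect_all closed_Collect_conj closed_Collect_le closed_Collect_eq continuous_intros)

lemma closed_density_ops: "closed density_ops"
  unfolding density_ops_def
  by (intro closed_Collect_conj closed_psd closed_Collect_eq continuous_intros)

lemma continuous_on_reduce_A [continuous_intros]:
  fixes f :: "'z::topological_space \<Rightarrow> ('a::finite \<times> 'b::finite) operator"
  shows "continuous_on S f \<Longrightarrow> continuous_on S (\<lambda>x. reduce_A (f x))"
  unfolding reduce_A_def by (intro continuous_intros continuous_on_vec_lambda)

lemma continuous_on_tensor_op [continuous_intros]:
  assumes "continuous_on S f" "continuous_on S g"
  shows "continuous_on S (\<lambda>x. tensor_op (f x) (g x))"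
  unfolding tensor_op_def using assms by (intro continuous_intros continuous_on_vec_lambda)

lemma closed_choi_states: "closed (choi_states :: ('a::finite \<times> 'b::finite) operator set)"
proof -
  have eq: "choi_states = density_ops \<inter> {\<rho> :: ('a \<times> 'b) operator. reduce_A \<rho> = (1 / real CARD('a)) *\<^sub>R mat 1}"
    by (auto simp: choi_states_def)
  show ?thesis
    unfolding eq by (intro closed_Int closed_density_ops closed_Collect_eq continuous_intros)
qed

text \<open>On a compact set of positive semidefinite operators, squaring is a continuous injection, so its
  inverse is continuous there.\<close>

lemma continuous_on_op_sqrt: "continuous_on {X :: 'n::finite operator. psd X} op_sqrt"
  unfolding continuous_on_eq_continuous_within
proof
  fix X :: "'n operator" assume "X \<in> {X. psd X}"
  then have X: "psd X" by simp
  \<comment> \<open>The squared Frobenius norm of a root is the trace, so all operators of trace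
    below \<open>r\<close> have roots in one compact ball; the \<open>+ 1\<close> makes this an open
    neighbourhood of \<open>X\<close>.\<close>
  define r where "r = Re (trace X) + 1"
  define C where "C = {Y :: 'n operator. psd Y} \<inter> cball 0 (sqrt r)"
  define U where "U = {Z :: 'n operator. Re (trace Z) < r}"
  have U: "open U" "X \<in> U"
    unfolding U_def by (auto simp: r_def intro!: open_Collect_less continuous_intros)
  have "compact C"
    unfolding C_def by (intro closed_Int_compact closed_psd compact_cball)
  then have "continuous_on ((\<lambda>Y. Y ** Y) ` C) op_sqrt"
    by (intro continuous_on_inv continuous_intros) (auto simp: C_def op_sqrt_eqI)
  moreover have "{Z. psd Z} \<inter> U \<subseteq> (\<lambda>Y. Y ** Y) ` C"
  proof
    fix Z assume "Z \<in> {Z. psd Z} \<inter> U"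
    then have Z: "psd Z" "Re (trace Z) < r" by (auto simp: U_def)
    have "norm (op_sqrt Z) \<le> sqrt r"
      using norm_op_sqrt[OF Z(1)] Z(2) by (intro real_le_rsqrt) simp
    then have "op_sqrt Z \<in> C" using Z by (simp add: C_def psd_op_sqrt)
    then show "Z \<in> (\<lambda>Y. Y ** Y) ` C"
      using op_sqrt_mult_self[OF Z(1)] by force
  qed
  ultimately have "continuous_on ({Z. psd Z} \<inter> U) op_sqrt"
    by (rule continuous_on_subset)
  then have "continuous (at X within ({Z. psd Z} \<inter> U)) op_sqrt"
    using X U by (simp add: continuous_on_eq_continuous_within)
  moreover have "at X within ({Z. psd Z} \<inter> U) = at X within {Z. psd Z}"
    using U by (intro at_within_nhd[of X U]) auto
  ultimately show "continuous (at X within {X. psd X}) op_sqrt" by simp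
qed

lemma continuous_on_fidelity: "continuous_on {\<sigma> :: 'n::finite operator. psd \<sigma>} (fidelity \<rho>)"
proof -
  have "continuous_on {\<sigma> :: 'n operator. psd \<sigma>}
      (\<lambda>\<sigma>. op_sqrt (adjoint_op (op_sqrt \<rho> ** op_sqrt \<sigma>) ** (op_sqrt \<rho> ** op_sqrt \<sigma>)))"
    by (rule continuous_on_compose2[OF continuous_on_op_sqrt])
      (auto intro!: continuous_intros continuous_on_op_sqrt psd_adjoint_mult)
  then show ?thesis
    unfolding fidelity_def trace_norm_def by (intro continuous_intros)
qed

lemma closed_fidelity_ge:
  assumes "closed C" "C \<subseteq> {\<sigma>. psd \<sigma>}"
  shows "closed {\<sigma> \<in> C. r \<le> fidelity \<rho> \<sigma>}"
  using assms continuous_on_subset[OF continuous_on_fidelity]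
  by (intro continuous_on_closed_Collect_le continuous_intros) blast+

lemma continuous_on_det [continuous_intros]:
  fixes f :: "'z::topological_space \<Rightarrow> 'n::finite operator"
  shows "continuous_on S f \<Longrightarrow> continuous_on S (\<lambda>x. det (f x))"
  unfolding det_def by (intro continuous_intros)

text \<open>Cramer's rule writes every entry as a quotient of determinants with nonvanishing
  denominator.\<close>

lemma continuous_on_matrix_inv:
  "continuous_on {X :: 'n::finite operator. invertible X} matrix_inv"
proof -
  have cramer': "matrix_inv X = (\<chi> k j. det (\<chi> i l. if l = k then mat 1 $ i $ j else X $ i $ l) / det X)"
    if "invertible X" for X :: "'n operator"
  proof -
    have "X *v (column j (matrix_inv X)) = column j (mat 1)" for j
      using matrix_inv_inverse(2)[OF that]
      by (simp add: vec_eq_iff matrix_vector_mult_def matrix_matrix_mult_def column_def)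
    moreover have "det X \<noteq> 0"
      using that by (simp add: invertible_det_nz)
    ultimately have "column j (matrix_inv X) = (\<chi> k. det (\<chi> i l. if l = k then column j (mat 1) $ i else X $ i $ l) / det X)" for j
      using iffD1[OF cramer] by blast
    then show ?thesis by (simp add: vec_eq_iff column_def cong: if_cong)
  qed
  have if_vec: "continuous_on S (\<lambda>X :: 'n operator. if l = k then c else X $ i $ l)" for S l k c i
    by (cases "l = k") (auto intro!: continuous_intros)
  have "continuous_on {X :: 'n operator. invertible X}
      (\<lambda>X. \<chi> k j. det (\<chi> i l. if l = k then mat 1 $ i $ j else X $ i $ l) / det X)"
    by (intro continuous_intros continuous_on_vec_lambda if_vec) (simp add: invertible_det_nz)
  then show ?thesis
    by (rule continuous_on_eq) (simp add: cramer')
qed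

lemma pos_def_borel: "{X :: 'n::finite operator. pos_def X} \<in> sets borel"
proof -
  have "open {X :: 'n operator. det X \<noteq> 0}"
    by (intro open_Collect_neq continuous_intros)
  then have "{X :: 'n operator. psd X} \<inter> {X. det X \<noteq> 0} \<in> sets borel"
    by (intro sets.Int borel_closed closed_psd borel_open)
  moreover have "{X :: 'n operator. pos_def X} = {X. psd X} \<inter> {X. det X \<noteq> 0}"
    by (auto simp: pos_def_iff invertible_det_nz)
  ultimately show ?thesis by simp
qed

text \<open>Outside the positive definite operators the junk values of \<open>THE\<close> and \<open>SOME\<close> make the
  inverse square root piecewise constant.\<close>

lemma borel_measurable_inv_sqrt: "(\<lambda>X :: 'n::finite operator. matrix_inv (op_sqrt X)) \<in> borel_measurable borel"
proof -
  let ?h = "\<lambda>X :: 'n operator. matrix_inv (op_sqrt X)"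
  \<comment> \<open>A choice from an unsatisfiable predicate does not depend on the \<open>X\<close>
    it came from: \<open>c1\<close> is the value at singular roots, \<open>c2\<close> the value
    where no root exists.\<close>
  define c1 where "c1 = (SOME Y :: 'n operator. False)"
  define c2 where "c2 = matrix_inv (THE Y :: 'n operator. False)"
  have c1: "?h X = c1" if "psd X" "\<not> pos_def X" for X
  proof -
    have "\<not> invertible (op_sqrt X)"
      using that invertible_mult[of "op_sqrt X" "op_sqrt X"] by (auto simp: pos_def_iff op_sqrt_mult_self)
    then have "(\<lambda>Y. op_sqrt X ** Y = mat 1 \<and> Y ** op_sqrt X = mat 1) = (\<lambda>Y. False)"
      by (auto simp: invertible_def)
    then show ?thesis
      unfolding matrix_inv_def c1_def by (rule arg_cong)
  qed
  have c2: "?h X = c2" if "\<not> psd X" for X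
  proof -
    have "\<not> (psd Y \<and> Y ** Y = X)" for Y
      using that psd_adjoint_mult[of Y] by (auto simp: psd_hermitian)
    then have "(\<lambda>Y. psd Y \<and> Y ** Y = X) = (\<lambda>Y. False)" by blast
    then show ?thesis unfolding op_sqrt_def c2_def by simp
  qed
  have "continuous_on {X. pos_def X} ?h"
    by (rule continuous_on_compose2[OF continuous_on_matrix_inv])
      (auto simp: pos_def_def invertible_op_sqrt intro: continuous_on_subset[OF continuous_on_op_sqrt])
  then have h: "?h \<in> borel_measurable (restrict_space borel {X. pos_def X})"
    by (rule borel_measurable_continuous_on_restrict)
  have g: "(\<lambda>X :: 'n operator. if X \<in> {X. psd X} then c1 else c2) \<in> borel_measurable borel"
    by (intro measurable_If_set measurable_const) (simp_all add: borel_closed closed_psd)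
  have "(\<lambda>X. if X \<in> {X. pos_def X} then ?h X else if X \<in> {X. psd X} then c1 else c2) \<in> borel_measurable borel"
    using pos_def_borel by (subst measurable_If_restrict_space_iff) (auto intro!: h measurable_restrict_space1 g[simplified])
  moreover have "(\<lambda>X. if X \<in> {X. pos_def X} then ?h X else if X \<in> {X. psd X} then c1 else c2) = ?h"
    using c1 c2 by (auto simp: fun_eq_iff)
  ultimately show ?thesis by simp
qed

text \<open>A jointly continuous function of the inverse root and the operator, composed with a
  Borel map. Measurability on the whole space is what \<open>distr\<close> calls for in the lifted
  procedure.\<close>

lemma borel_measurable_proj_choi:
  "(proj_choi :: ('a::finite \<times> 'b::finite) operator \<Rightarrow> _) \<in> borel_measurable borel"
proof -
  have red: "reduce_A \<in> borel_measurable (borel :: ('a \<times> 'b) operator measure)"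
    by (intro borel_measurable_continuous_onI continuous_intros)
  have "(\<lambda>\<rho> :: ('a \<times> 'b) operator. (\<lambda>R P. (1 / real CARD('a)) *\<^sub>R
      (tensor_op R (mat 1) ** P ** tensor_op R (mat 1))) (matrix_inv (op_sqrt (reduce_A \<rho>))) \<rho>)
      \<in> borel_measurable borel"
    by (rule borel_measurable_continuous_Pair[OF measurable_compose[OF red borel_measurable_inv_sqrt]])
      (auto intro!: continuous_intros)
  then show ?thesis
    by (simp add: proj_choi_def[abs_def] normalize_A_def Let_def)
qed

subsection \<open>Lifting tomography from states to channels\<close>

text \<open>On estimates with positive definite marginal the event is the preimage of a closed set
  of Choi states. Its measurability permits comparing probabilities by monotonicity.\<close>

lemma proj_choi_success_borel:
  "{\<rho>' \<in> density_ops. pos_def (reduce_A \<rho>') \<and> r \<le> fidelity \<rho> (proj_choi \<rho>')}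
    \<in> sets (borel :: ('a::finite \<times> 'b::finite) operator measure)"
proof -
  let ?P = "{\<rho>' :: ('a \<times> 'b) operator. pos_def (reduce_A \<rho>')}"
  have "closed {\<sigma> \<in> choi_states. r \<le> fidelity \<rho> \<sigma>}"
    by (intro closed_fidelity_ge closed_choi_states) (auto simp: choi_states_def density_ops_psd)
  then have "proj_choi -` {\<sigma> \<in> choi_states. r \<le> fidelity \<rho> \<sigma>} \<inter> space borel \<in> sets borel"
    by (intro measurable_sets[OF borel_measurable_proj_choi] borel_closed)
  moreover have "?P \<in> sets borel"
  proof -
    have "reduce_A \<in> borel_measurable (borel :: ('a \<times> 'b) operator measure)"
      by (intro borel_measurable_continuous_onI continuous_intros)
    from measurable_sets[OF this pos_def_borel] show ?thesis by (simp add: vimage_def)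
  qed
  moreover have "density_ops \<in> sets (borel :: ('a \<times> 'b) operator measure)"
    by (intro borel_closed closed_density_ops)
  ultimately have "density_ops \<inter> ?P \<inter> (proj_choi -` {\<sigma> \<in> choi_states. r \<le> fidelity \<rho> \<sigma>} \<inter> space borel) \<in> sets borel"
    by blast
  also have "density_ops \<inter> ?P \<inter> (proj_choi -` {\<sigma> \<in> choi_states. r \<le> fidelity \<rho> \<sigma>} \<inter> space borel)
      = {\<rho>' \<in> density_ops. pos_def (reduce_A \<rho>') \<and> r \<le> fidelity \<rho> (proj_choi \<rho>')}"
    using proj_choi_in_choi_states by auto
  finally show ?thesis .
qed

text \<open>Outside a null set, an estimate with infidelity at most \<open>\<epsilon> / 4\<close> is
  projected to one with infidelity at most \<open>\<epsilon>\<close>, so the good event for states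
  is almost surely contained in that for channels.\<close>

lemma proj_choi_success:
  fixes M :: "('a::finite \<times> 'b::finite) operator measure"
  assumes M: "prob_space M" "sets M = sets borel" "AE \<sigma> in M. \<sigma> \<in> density_ops"
    and pd: "AE \<sigma> in M. pos_def (reduce_A \<sigma>)" and \<rho>: "\<rho> \<in> choi_states"
    and est: "measure M {\<sigma> \<in> density_ops. 1 - \<epsilon> / 4 \<le> fidelity \<rho> \<sigma>} \<ge> p"
  shows "measure M {\<rho>' \<in> density_ops. pos_def (reduce_A \<rho>') \<and> 1 - \<epsilon> \<le> fidelity \<rho> (proj_choi \<rho>')} \<ge> p"
proof -
  interpret prob_space M by (rule M)
  have "AE \<sigma> in M. \<sigma> \<in> {\<sigma> \<in> density_ops. 1 - \<epsilon> / 4 \<le> fidelity \<rho> \<sigma>} \<longrightarrow>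
      \<sigma> \<in> {\<rho>' \<in> density_ops. pos_def (reduce_A \<rho>') \<and> 1 - \<epsilon> \<le> fidelity \<rho> (proj_choi \<rho>')}"
    using pd
  proof eventually_elim
    case (elim \<sigma>)
    then show ?case using fidelity_proj_choi[OF \<rho>, of \<sigma>] by auto
  qed
  then have "measure M {\<sigma> \<in> density_ops. 1 - \<epsilon> / 4 \<le> fidelity \<rho> \<sigma>}
      \<le> measure M {\<rho>' \<in> density_ops. pos_def (reduce_A \<rho>') \<and> 1 - \<epsilon> \<le> fidelity \<rho> (proj_choi \<rho>')}"
    by (rule finite_measure_mono_AE) (simp add: M(2) proj_choi_success_borel)
  with est show ?thesis by linarith
qed

lemma state_tomographyD:
  assumes "state_tomography alg N \<delta>" "0 < \<epsilon>" "\<epsilon> < 1" "\<rho> \<in> density_ops"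
  shows "prob_space (alg \<epsilon> (copies (N \<epsilon>) \<rho>))"
    and "sets (alg \<epsilon> (copies (N \<epsilon>) \<rho>)) = sets borel"
    and "AE \<sigma> in alg \<epsilon> (copies (N \<epsilon>) \<rho>). \<sigma> \<in> density_ops"
    and "measure (alg \<epsilon> (copies (N \<epsilon>) \<rho>)) {\<sigma> \<in> density_ops. fidelity \<rho> \<sigma> \<ge> 1 - \<epsilon>} \<ge> 1 - \<delta>"
  using assms by (auto simp: state_tomography_def Let_def)

text \<open>Removes the quantifier over channels by Choi's theorem, leaving an event already known
  to be Borel.\<close>

lemma proj_choi_channel_success_eq:
  "{\<rho>' \<in> density_ops. pos_def (reduce_A \<rho>') \<and>
      (\<exists>\<Psi>. quantum_channel \<Psi> \<and> choi \<Psi> = proj_choi \<rho>' \<and> r \<le> fidelity \<rho> (choi \<Psi>))}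
    = {\<rho>' \<in> density_ops. pos_def (reduce_A \<rho>') \<and> r \<le> fidelity \<rho> (proj_choi \<rho>')}"
proof -
  have "(\<exists>\<Psi>. quantum_channel \<Psi> \<and> choi \<Psi> = \<sigma> \<and> r \<le> fidelity \<rho> (choi \<Psi>)) \<longleftrightarrow> r \<le> fidelity \<rho> \<sigma>"
    if "\<sigma> \<in> choi_states" for \<sigma>
    using choi_states_iff[of \<sigma>] that by auto
  then show ?thesis
    using proj_choi_in_choi_states by blast
qed

lemma proj_choi_channel_tomography:
  fixes alg :: "real \<Rightarrow> ('a::finite \<times> 'b::finite) multi_operator \<Rightarrow> ('a \<times> 'b) operator measure"
    and \<Phi> :: "'a operator \<Rightarrow> 'b operator" and N :: "real \<Rightarrow> nat" and \<epsilon> \<delta> :: real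
  defines "M \<equiv> alg (\<epsilon> / 4) (copies (N (\<epsilon> / 4)) (choi \<Phi>))"
  assumes \<epsilon>: "0 < \<epsilon>" "\<epsilon> < 1" and alg: "state_tomography alg N \<delta>" and \<Phi>: "quantum_channel \<Phi>"
    and pd: "AE \<rho>' in M. pos_def (reduce_A \<rho>')"
  shows "AE \<rho>' in M. \<exists>!\<Psi>. quantum_channel \<Psi> \<and> choi \<Psi> = proj_choi \<rho>'"
    and "measure M {\<rho>' \<in> density_ops. pos_def (reduce_A \<rho>') \<and>
      (\<exists>\<Psi>. quantum_channel \<Psi> \<and> choi \<Psi> = proj_choi \<rho>' \<and> fidelity (choi \<Phi>) (choi \<Psi>) \<ge> 1 - \<epsilon>)} \<ge> 1 - \<delta>"
proof -
  note choi = choi_in_choi_states[OF \<Phi>]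
  have \<epsilon>4: "0 < \<epsilon> / 4" "\<epsilon> / 4 < 1" using \<epsilon> by auto
  note D = state_tomographyD[OF alg \<epsilon>4 choi_states_density[OF choi], folded M_def]
  show "AE \<rho>' in M. \<exists>!\<Psi>. quantum_channel \<Psi> \<and> choi \<Psi> = proj_choi \<rho>'"
    using pd D(3) by eventually_elim (intro choi_channel_unique proj_choi_in_choi_states)
  show "measure M {\<rho>' \<in> density_ops. pos_def (reduce_A \<rho>') \<and>
      (\<exists>\<Psi>. quantum_channel \<Psi> \<and> choi \<Psi> = proj_choi \<rho>' \<and> fidelity (choi \<Phi>) (choi \<Psi>) \<ge> 1 - \<epsilon>)} \<ge> 1 - \<delta>"
    unfolding proj_choi_channel_success_eq using pd D by (intro proj_choi_success choi)
qed

lemma process_tomography_proj_choi: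
  fixes alg :: "real \<Rightarrow> ('a::finite \<times> 'b::finite) multi_operator \<Rightarrow> ('a \<times> 'b) operator measure"
  assumes \<epsilon>: "0 < \<epsilon>" "\<epsilon> < 1" and alg: "state_tomography alg N \<delta>"
    and pd: "\<And>\<Phi> :: 'a operator \<Rightarrow> 'b operator. quantum_channel \<Phi> \<Longrightarrow>
      AE \<rho>' in alg (\<epsilon> / 4) (copies (N (\<epsilon> / 4)) (choi \<Phi>)). pos_def (reduce_A \<rho>')"
  shows "process_tomography (\<lambda>X. distr (alg (\<epsilon> / 4) X) borel proj_choi) (N (\<epsilon> / 4)) \<epsilon> \<delta>"
  unfolding process_tomography_def Let_def
proof (intro allI impI)
  fix \<Phi> :: "'a operator \<Rightarrow> 'b operator"
  assume \<Phi>: "quantum_channel \<Phi>"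
  define M where "M = alg (\<epsilon> / 4) (copies (N (\<epsilon> / 4)) (choi \<Phi>))"
  note choi = choi_in_choi_states[OF \<Phi>]
  have \<epsilon>4: "0 < \<epsilon> / 4" "\<epsilon> / 4 < 1" using \<epsilon> by auto
  note D = state_tomographyD[OF alg \<epsilon>4 choi_states_density[OF choi], folded M_def]
  note pdM = pd[OF \<Phi>, folded M_def]
  interpret prob_space M by (rule D)
  have meas: "proj_choi \<in> measurable M borel"
    using borel_measurable_proj_choi D(2) by (simp cong: measurable_cong_sets)
  let ?T = "{choi \<Psi> |\<Psi> :: 'a operator \<Rightarrow> 'b operator. quantum_channel \<Psi> \<and> fidelity (choi \<Phi>) (choi \<Psi>) \<ge> 1 - \<epsilon>}"
  have T: "?T = {\<sigma> \<in> choi_states. 1 - \<epsilon> \<le> fidelity (choi \<Phi>) \<sigma>}"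
    by (auto simp: choi_states_iff)
  \<comment> \<open>Through the Choi correspondence this set of channel images becomes a superlevel
    set of the fidelity on a closed set.\<close>
  have "closed ?T"
    unfolding T by (intro closed_fidelity_ge closed_choi_states) (auto simp: choi_states_def density_ops_psd)
  then have Tborel: "?T \<in> sets borel" by (rule borel_closed)
  have "AE \<sigma> in M. proj_choi \<sigma> \<in> choi_states"
    using pdM D(3) by eventually_elim (rule proj_choi_in_choi_states)
  then have AE: "AE \<sigma> in distr M borel proj_choi. \<sigma> \<in> choi_states"
    using meas borel_closed[OF closed_choi_states] by (subst AE_distr_iff) auto
  have "1 - \<delta> \<le> measure M {\<rho>' \<in> density_ops. pos_def (reduce_A \<rho>') \<and> 1 - \<epsilon> \<le> fidelity (choi \<Phi>) (proj_choi \<rho>')}"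
    using D pdM choi by (intro proj_choi_success)
  \<comment> \<open>Only an inclusion is claimed: default values of \<open>proj_choi\<close> at
    other operators might also land in \<open>?T\<close>.\<close>
  also have "\<dots> \<le> measure M (proj_choi -` ?T \<inter> space M)"
  proof (rule finite_measure_mono)
    show "{\<rho>' \<in> density_ops. pos_def (reduce_A \<rho>') \<and> 1 - \<epsilon> \<le> fidelity (choi \<Phi>) (proj_choi \<rho>')}
        \<subseteq> proj_choi -` ?T \<inter> space M"
      using proj_choi_in_choi_states sets_eq_imp_space_eq[OF D(2)] unfolding T by auto
    show "proj_choi -` ?T \<inter> space M \<in> sets M"
      by (rule measurable_sets[OF meas Tborel])
  qed
  also have "\<dots> = measure (distr M borel proj_choi) ?T"
    by (rule measure_distr[OF meas Tborel, symmetric])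
  finally show "prob_space (distr (alg (\<epsilon> / 4) (copies (N (\<epsilon> / 4)) (choi \<Phi>))) borel proj_choi) \<and>
      sets (distr (alg (\<epsilon> / 4) (copies (N (\<epsilon> / 4)) (choi \<Phi>))) borel proj_choi) = sets borel \<and>
      (AE \<sigma> in distr (alg (\<epsilon> / 4) (copies (N (\<epsilon> / 4)) (choi \<Phi>))) borel proj_choi.
         \<exists>\<Psi> :: 'a operator \<Rightarrow> 'b operator. quantum_channel \<Psi> \<and> choi \<Psi> = \<sigma>) \<and>
      1 - \<delta> \<le> measure (distr (alg (\<epsilon> / 4) (copies (N (\<epsilon> / 4)) (choi \<Phi>))) borel proj_choi) ?T"
    using AE prob_space_distr[OF meas] unfolding M_def[symmetric] by (simp add: choi_states_iff)
qed

theorem theorem1: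
  "(\<forall>\<rho> :: ('a::finite \<times> 'b::finite) operator.
      \<rho> \<in> density_ops \<and> pos_def (reduce_A \<rho>) \<longrightarrow>
        (\<forall>\<sigma>. is_arg_max (fidelity \<rho>) (\<lambda>\<tau>. \<tau> \<in> choi_states) \<sigma> \<longleftrightarrow> \<sigma> = normalize_A \<rho>) \<and>
        (\<forall>\<sigma>. is_arg_min (bures_dist \<rho>) (\<lambda>\<tau>. \<tau> \<in> choi_states) \<sigma> \<longleftrightarrow> \<sigma> = normalize_A \<rho>) \<and>
        (\<forall>\<sigma>. is_arg_min (purified_dist \<rho>) (\<lambda>\<tau>. \<tau> \<in> choi_states) \<sigma> \<longleftrightarrow> \<sigma> = normalize_A \<rho>))
   \<and>
   (\<forall>(\<rho> :: ('a \<times> 'b) operator) \<rho>'.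
      \<rho> \<in> choi_states \<and> \<rho>' \<in> density_ops \<and> pos_def (reduce_A \<rho>') \<longrightarrow>
        bures_dist \<rho> (proj_choi \<rho>') \<le> 2 * bures_dist \<rho> \<rho>' \<and>
        1 - fidelity \<rho> (proj_choi \<rho>') \<le> 4 * (1 - fidelity \<rho> \<rho>'))
   \<and>
   (\<forall>(\<epsilon>::real) (\<delta>::real)
      (alg :: real \<Rightarrow> ('a \<times> 'b) multi_operator \<Rightarrow> ('a \<times> 'b) operator measure) N.
      0 < \<epsilon> \<and> \<epsilon> < 1 \<and> 0 < \<delta> \<and> \<delta> < 1 \<and> state_tomography alg N \<delta> \<longrightarrow>
        (\<forall>\<Phi> :: 'a operator \<Rightarrow> 'b operator.
           quantum_channel \<Phi> \<and>
           (AE \<rho>' in alg (\<epsilon> / 4) (copies (N (\<epsilon> / 4)) (choi \<Phi>)). pos_def (reduce_A \<rho>')) \<longrightarrow>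
             (AE \<rho>' in alg (\<epsilon> / 4) (copies (N (\<epsilon> / 4)) (choi \<Phi>)).
                \<exists>!\<Psi>. quantum_channel \<Psi> \<and> choi \<Psi> = proj_choi \<rho>') \<and>
             measure (alg (\<epsilon> / 4) (copies (N (\<epsilon> / 4)) (choi \<Phi>)))
               {\<rho>' \<in> density_ops. pos_def (reduce_A \<rho>') \<and>
                  (\<exists>\<Psi>. quantum_channel \<Psi> \<and> choi \<Psi> = proj_choi \<rho>' \<and>
                       fidelity (choi \<Phi>) (choi \<Psi>) \<ge> 1 - \<epsilon>)} \<ge> 1 - \<delta>) \<and>
        ((\<forall>\<Phi> :: 'a operator \<Rightarrow> 'b operator. quantum_channel \<Phi> \<longrightarrow>
            (AE \<rho>' in alg (\<epsilon> / 4) (copies (N (\<epsilon> / 4)) (choi \<Phi>)). pos_def (reduce_A \<rho>'))) \<longrightarrow>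
           process_tomography (\<lambda>X. distr (alg (\<epsilon> / 4) X) borel proj_choi) (N (\<epsilon> / 4)) \<epsilon> \<delta>))"
proof (intro conjI allI impI; (elim conjE)?)
  fix \<rho> \<sigma> :: "('a \<times> 'b) operator"
  assume "\<rho> \<in> density_ops" and pd: "pos_def (reduce_A \<rho>)"
  then have \<rho>: "psd \<rho>" by (simp add: density_ops_psd)
  note max = normalize_A_unique_maximizer[OF \<rho> pd, of \<sigma>]
  show "is_arg_max (fidelity \<rho>) (\<lambda>\<tau>. \<tau> \<in> choi_states) \<sigma> \<longleftrightarrow> \<sigma> = normalize_A \<rho>"
    by (rule max)
  show "is_arg_min (bures_dist \<rho>) (\<lambda>\<tau>. \<tau> \<in> choi_states) \<sigma> \<longleftrightarrow> \<sigma> = normalize_A \<rho>"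
    using max by (subst is_arg_min_iff_is_arg_max) (rule bures_dist_less_iff)
  show "is_arg_min (purified_dist \<rho>) (\<lambda>\<tau>. \<tau> \<in> choi_states) \<sigma> \<longleftrightarrow> \<sigma> = normalize_A \<rho>"
    using max by (subst is_arg_min_iff_is_arg_max) (rule purified_dist_less_iff)
next
  fix \<rho> \<rho>' :: "('a \<times> 'b) operator"
  assume "\<rho> \<in> choi_states" "\<rho>' \<in> density_ops" "pos_def (reduce_A \<rho>')"
  then show "bures_dist \<rho> (proj_choi \<rho>') \<le> 2 * bures_dist \<rho> \<rho>'"
    and "1 - fidelity \<rho> (proj_choi \<rho>') \<le> 4 * (1 - fidelity \<rho> \<rho>')"
    by (rule bures_dist_proj_choi, rule fidelity_proj_choi)
qed (rule proj_choi_channel_tomography process_tomography_proj_choi; blast)+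

end
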